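(* Let $s\geq 3$ be an integer and let $n$ be a positive integer. Let $G$ be an $s$-admissible balanced $(s+1)$-partite graph on $(s+1)n$ vertices with $\hat\delta(G)\geq(1-c)n$, where $c$ is a real number with $$c\leq\frac{1}{3s^3(s-2)^2}.$$ Then $G$ admits a fractional $K_s$-decomposition.
   Context: All graphs are finite, undirected and simple. An $(s+1)$-partite graph $G$ with parts $V_1,\dots,V_{s+1}$ (a partition of $V(G)$ with no edge inside any part) is balanced if all parts have the same size. $d(v)$ is the degree of $v$, $d(v,U)$ the number of neighbours of $v$ in $U$, and $E(V_i,V_j)$ the set of edges between $V_i$ and $V_j$. The partite minimum degree is $\hat\delta(G)=\min\{d(v,V_i):1\leq i\leq s+1,\ v\in V(G)\setminus V_i\}$. The $(s+1)$-partite graph $G$ is called $s$-admissible if (i) $d(v,V_k)\leq\frac{d(v)}{s-1}$ for all $v\in V(G)$ and $1\leq k\leq s+1$, and (ii) $|E(V_i,V_j)|=\frac{d_i+d_j}{s-1}-\frac{|E(G)|}{\binom{s}{2}}$ for all $1\leq i<j\leq s+1$, where $d_\ell=\sum_{k\neq\ell}|E(V_\ell,V_k)|$. A copy of $K_s$ in $G$ is a subgraph of $G$ isomorphic to the complete graph on $s$ vertices. A fractional $K_s$-decomposition of $G$ is a weight function $w$ from the set of copies of $K_s$ in $G$ to $[0,1]$ such that for each edge $e\in E(G)$ the total weight of the copies of $K_s$ containing $e$ equals $1$. *)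

theory Defs
  imports Complex_Main "HOL-Library.Ramsey" "HOL-Library.Disjoint_Sets"
begin

record 'a sgraph =
  verts :: "'a set"
  edges :: "'a set set"

(* [A]^k (nsets A k) is the set of all k-element subsets of A. *)
definition simple_graph :: "'a sgraph \<Rightarrow> bool" where
  "simple_graph G \<longleftrightarrow> finite (verts G) \<and> edges G \<subseteq> [verts G]\<^bsup>2\<^esup>"

definition subgraph_of :: "'a sgraph \<Rightarrow> 'a sgraph \<Rightarrow> bool" where
  "subgraph_of H G \<longleftrightarrow> simple_graph H \<and> verts H \<subseteq> verts G \<and> edges H \<subseteq> edges G"

definition isomorphic :: "'a sgraph \<Rightarrow> 'b sgraph \<Rightarrow> bool" where
  "isomorphic G H \<longleftrightarrow> (\<exists>f. bij_betw f (verts G) (verts H) \<and>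
     (\<forall>u\<in>verts G. \<forall>v\<in>verts G. {u, v} \<in> edges G \<longleftrightarrow> {f u, f v} \<in> edges H))"

definition complete_graph :: "nat \<Rightarrow> nat sgraph" where
  "complete_graph s = \<lparr>verts = {..<s}, edges = [{..<s}]\<^bsup>2\<^esup>\<rparr>"

definition clique_copies :: "nat \<Rightarrow> 'a sgraph \<Rightarrow> 'a sgraph set" where
  "clique_copies s G = {H. subgraph_of H G \<and> isomorphic H (complete_graph s)}"

definition degree :: "'a sgraph \<Rightarrow> 'a \<Rightarrow> nat" where
  "degree G v = card {u \<in> verts G. {u, v} \<in> edges G}"

definition degree_into :: "'a sgraph \<Rightarrow> 'a \<Rightarrow> 'a set \<Rightarrow> nat" where
  "degree_into G v U = card {u \<in> U. {u, v} \<in> edges G}"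

definition edges_between :: "'a sgraph \<Rightarrow> 'a set \<Rightarrow> 'a set \<Rightarrow> 'a set set" where
  "edges_between G A B = {e \<in> edges G. \<exists>a\<in>A. \<exists>b\<in>B. e = {a, b}}"

(* In the following, the parts of an r-partite graph are V 1, ..., V r;
   values of V outside {1..r} are irrelevant. *)
definition partite :: "nat \<Rightarrow> (nat \<Rightarrow> 'a set) \<Rightarrow> 'a sgraph \<Rightarrow> bool" where
  "partite r V G \<longleftrightarrow> simple_graph G \<and> disjoint_family_on V {1..r} \<and>
     (\<Union>i\<in>{1..r}. V i) = verts G \<and> (\<forall>i\<in>{1..r}. edges_between G (V i) (V i) = {})"

definition balanced :: "nat \<Rightarrow> (nat \<Rightarrow> 'a set) \<Rightarrow> bool" where
  "balanced r V \<longleftrightarrow> (\<forall>i\<in>{1..r}. \<forall>j\<in>{1..r}. card (V i) = card (V j))"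

(* The minimum is over a nonempty set whenever r \<ge> 2 and the graph has a vertex. *)
definition partite_min_degree :: "nat \<Rightarrow> (nat \<Rightarrow> 'a set) \<Rightarrow> 'a sgraph \<Rightarrow> nat" where
  "partite_min_degree r V G =
     Min {degree_into G v (V i) | i v. i \<in> {1..r} \<and> v \<in> verts G - V i}"

definition part_degree :: "nat \<Rightarrow> (nat \<Rightarrow> 'a set) \<Rightarrow> 'a sgraph \<Rightarrow> nat \<Rightarrow> nat" where
  "part_degree r V G l = (\<Sum>k\<in>{1..r} - {l}. card (edges_between G (V l) (V k)))"

definition admissible :: "nat \<Rightarrow> (nat \<Rightarrow> 'a set) \<Rightarrow> 'a sgraph \<Rightarrow> bool" where
  "admissible s V G \<longleftrightarrow>
     (\<forall>v\<in>verts G. \<forall>k\<in>{1..s+1}.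
        real (degree_into G v (V k)) \<le> real (degree G v) / (real s - 1)) \<and>
     (\<forall>i\<in>{1..s+1}. \<forall>j\<in>{1..s+1}. i < j \<longrightarrow>
        real (card (edges_between G (V i) (V j))) =
          (real (part_degree (s+1) V G i) + real (part_degree (s+1) V G j)) / (real s - 1)
            - real (card (edges G)) / real (s choose 2))"

(* Only the values of w on copies of the complete graph matter. *)
definition fractional_clique_decomposition ::
    "nat \<Rightarrow> 'a sgraph \<Rightarrow> ('a sgraph \<Rightarrow> real) \<Rightarrow> bool" where
  "fractional_clique_decomposition s G w \<longleftrightarrow>
     (\<forall>H\<in>clique_copies s G. 0 \<le> w H \<and> w H \<le> 1) \<and>
     (\<forall>e\<in>edges G. (\<Sum>H\<in>{H \<in> clique_copies s G. e \<in> edges H}. w H) = 1)"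

end

theory Submission
  imports Defs
begin

text \<open>
  A copy of \<open>K\<^sub>s\<close> in \<open>G\<close> misses exactly one part. Choosing an arbitrary vertex of the missed part turns
  the copies into pairs \<open>(t, k)\<close>, where the transversal \<open>t\<close> picks one vertex from every part and
  \<open>k\<close> is the missed part. All weightings below live on such pairs, which form a
  product set and are therefore easy to count.

  Write \<open>W = |E(G)| / (s choose 2)\<close>. A decomposition has total weight \<open>W\<close>, and
  the copies missing \<open>V\<^sub>k\<close> must have total weight \<open>W\<^sub>k = W - d\<^sub>k / (s - 1)\<close>, where \<open>d\<^sub>k\<close> is the
  number of edges that meet \<open>V\<^sub>k\<close>. The hypothesis on the sizes of the sets
  \<open>E(V\<^sub>i, V\<^sub>j)\<close> says precisely that these totals put the right total load on each pair of
  parts (\<open>sum_missing_weight_pair\<close>). The initial weighting distributes \<open>W\<^sub>k\<close> uniformly over all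
  cliques missing \<open>V\<^sub>k\<close>. By the minimum degree condition the number of such cliques through an edge is nearly
  constant, so within each pair of parts the load differs from 1 by a small function that sums to
  zero (\<open>sum_deficit\<close>, \<open>deficit_range\<close>).

  That error is removed by elementary moves. If \<open>t\<close> is an \<open>(s + 1)\<close>-clique and remains one when
  its vertex \<open>u\<close> in \<open>V\<^sub>i\<close> is replaced by \<open>u'\<close>, then a suitable signed combination of the
  \<open>K\<^sub>s\<close> in these two cliques shifts one unit of load from \<open>u'v\<close> to \<open>uv\<close>, where \<open>v\<close> is the vertex
  of \<open>t\<close> in \<open>V\<^sub>j\<close>, and changes the load of no other edge. Averaging over all
  such \<open>t\<close> makes the change of each single weight tiny (\<open>correctable_swap\<close>). Three such moves lead from any edge
  to any other edge between the same two parts (\<open>correctable_path\<close>), and sending the surplus of each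
  edge evenly to all others cancels any error with zero sum (\<open>correctable_pair\<close>). Adding up the
  worst case over all pairs of parts, the correction never exceeds the initial weight
  (\<open>correction_small\<close>); so the corrected weights are nonnegative and all loads equal 1.
\<close>

section \<open>Dense balanced multipartite graphs\<close>

lemma real_choose_two: "real (m choose 2) = real m * (real m - 1) / 2"
  by (cases m) (auto simp: choose_two field_simps real_of_nat_div)

lemma choose_two_minus_one: "m \<ge> 2 \<Longrightarrow> real ((m choose 2) - 1) = real m * (real m - 1) / 2 - 1"
  by (simp add: real_choose_two[symmetric] of_nat_diff Suc_le_eq zero_less_binomial_iff)

text \<open>
  A smaller \<open>c\<close> only strengthens the density condition, so \<open>c\<close> is fixed to its largest admitted value;
  in particular it is positive. The density condition is stated through non-neighbours, the form in
  which union bounds consume it.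
\<close>
locale dense_partite_graph =
  fixes s n :: nat and c :: real and V :: "nat \<Rightarrow> 'a set" and G :: "'a sgraph"
  assumes s_ge: "s \<ge> 3" and n_pos: "n \<ge> 1"
    and partite: "partite (s + 1) V G"
    and card_part: "\<And>i. i \<in> {1..s+1} \<Longrightarrow> card (V i) = n"
    and few_nonneighbours: "\<And>i v. i \<in> {1..s+1} \<Longrightarrow> v \<in> verts G - V i \<Longrightarrow>
          real (card {x \<in> V i. {x, v} \<notin> edges G}) \<le> c * real n"
    and admissible: "admissible s V G"
    and c_eq: "c = 1 / (3 * real s ^ 3 * (real s - 2) ^ 2)"
begin

definition "I = {1..s+1}"

definition "transversals = PiE I V"

definition complete_on :: "(nat \<Rightarrow> 'a) \<Rightarrow> nat set \<Rightarrow> bool" where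
  "complete_on t J \<longleftrightarrow> (\<forall>p \<in> [J]\<^bsup>2\<^esup>. t ` p \<in> edges G)"

definition part_of :: "'a \<Rightarrow> nat" where
  "part_of v = (THE i. i \<in> I \<and> v \<in> V i)"

text \<open>
  Indexing by the set \<open>p\<close> of the two parts, rather than by an ordered pair, lets sums over all pairs
  of parts run over the 2-subsets of \<open>I\<close>.
\<close>
definition pair_edges :: "nat set \<Rightarrow> 'a set set" where
  "pair_edges p = {e \<in> edges G. part_of ` e = p}"

lemma finite_I [simp]: "finite I" and card_I [simp]: "card I = s + 1"
  by (auto simp: I_def)

lemma card_V: "i \<in> I \<Longrightarrow> card (V i) = n"
  using card_part by (auto simp: I_def)

lemma finite_V: "i \<in> I \<Longrightarrow> finite (V i)"
  using card_V n_pos card.infinite by fastforce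

lemma finite_transversals [simp]: "finite transversals"
  unfolding transversals_def by (intro finite_PiE) (auto intro: finite_V)

lemma verts_eq: "verts G = (\<Union>i\<in>I. V i)"
  using partite by (auto simp: partite_def I_def)

lemma parts_disjoint: "i \<in> I \<Longrightarrow> j \<in> I \<Longrightarrow> v \<in> V i \<Longrightarrow> v \<in> V j \<Longrightarrow> i = j"
  using partite unfolding partite_def I_def disjoint_family_on_def by blast

lemma part_of_eq: "i \<in> I \<Longrightarrow> v \<in> V i \<Longrightarrow> part_of v = i"
  unfolding part_of_def by (rule the_equality) (auto dest: parts_disjoint)

lemma finite_edges [simp]: "finite (edges G)"
proof -
  have "finite ([verts G]\<^bsup>2\<^esup>)"
    using partite by (auto simp: partite_def simple_graph_def nsets_def)
  then show ?thesis
    using partite finite_subset by (auto simp: partite_def simple_graph_def)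
qed

lemma edge_cases:
  assumes "e \<in> edges G"
  obtains i j u v where "i \<in> I" "j \<in> I" "i \<noteq> j" "u \<in> V i" "v \<in> V j" "e = {u, v}"
proof -
  have "e \<in> [verts G]\<^bsup>2\<^esup>"
    using partite assms by (auto simp: partite_def simple_graph_def)
  then obtain u v where uv: "e = {u, v}" "u \<in> verts G" "v \<in> verts G"
    by (auto simp: nsets_def card_2_iff)
  then obtain i j where ij: "i \<in> I" "j \<in> I" "u \<in> V i" "v \<in> V j"
    by (auto simp: verts_eq)
  have "i \<noteq> j"
  proof
    assume "i = j"
    then have "e \<in> edges_between G (V i) (V i)"
      using assms ij uv by (auto simp: edges_between_def)
    then show False
      using partite ij by (auto simp: partite_def I_def)
  qed
  with uv ij that show ?thesis by blast
qed

lemma pair_edges_eq: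
  assumes "i \<in> I" "j \<in> I" "i \<noteq> j"
  shows "pair_edges {i, j} = edges_between G (V i) (V j)"
proof (intro set_eqI iffI)
  fix e assume "e \<in> pair_edges {i, j}"
  then have e: "e \<in> edges G" "part_of ` e = {i, j}" by (auto simp: pair_edges_def)
  from e(1) obtain i' j' u v where *: "i' \<in> I" "j' \<in> I" "i' \<noteq> j'" "u \<in> V i'" "v \<in> V j'" "e = {u, v}"
    by (rule edge_cases)
  then have "part_of ` e = {i', j'}" by (simp add: part_of_eq)
  then have "{i', j'} = {i, j}" using e by simp
  then show "e \<in> edges_between G (V i) (V j)"
    using * e(1) by (auto simp: edges_between_def doubleton_eq_iff)
next
  fix e assume "e \<in> edges_between G (V i) (V j)"
  then show "e \<in> pair_edges {i, j}"
    using assms by (auto simp: edges_between_def pair_edges_def part_of_eq)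
qed

lemma pair_edgesE:
  assumes "e \<in> pair_edges {i, j}" "i \<in> I" "j \<in> I" "i \<noteq> j"
  obtains u v where "u \<in> V i" "v \<in> V j" "e = {u, v}" "{u, v} \<in> edges G"
  using assms by (auto simp: pair_edges_eq edges_between_def)

lemma pair_edges_subset: "pair_edges p \<subseteq> edges G"
  by (auto simp: pair_edges_def)

lemma finite_pair_edges [simp]: "finite (pair_edges p)"
  using finite_subset[OF pair_edges_subset] by simp

lemma transversal_in: "t \<in> transversals \<Longrightarrow> i \<in> I \<Longrightarrow> t i \<in> V i"
  by (auto simp: transversals_def)

lemma transversal_inj: "t \<in> transversals \<Longrightarrow> inj_on t I"
  by (metis inj_onI parts_disjoint transversal_in)

lemma edge_in_transversal_iff:
  assumes "t \<in> transversals" "i \<in> I" "j \<in> I" "i \<noteq> j" "u \<in> V i" "v \<in> V j"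
  shows "{u, v} \<subseteq> t ` (I - {k}) \<longleftrightarrow> t i = u \<and> t j = v \<and> k \<notin> {i, j}"
proof
  assume "{u, v} \<subseteq> t ` (I - {k})"
  then obtain a b where ab: "a \<in> I - {k}" "b \<in> I - {k}" "u = t a" "v = t b" by auto
  then have "a = i" "b = j"
    using assms transversal_in parts_disjoint by (metis DiffD1)+
  then show "t i = u \<and> t j = v \<and> k \<notin> {i, j}" using ab by auto
qed (use assms in auto)

lemma image_pair_eq_iff:
  assumes "t \<in> transversals" "i \<in> I" "j \<in> I" "i \<noteq> j" "u \<in> V i" "v \<in> V j"
  shows "t ` {i, j} = {u, v} \<longleftrightarrow> t i = u \<and> t j = v"
proof
  assume "t ` {i, j} = {u, v}"
  then have "(t i = u \<and> t j = v) \<or> (t i = v \<and> t j = u)"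
    by (auto simp: doubleton_eq_iff)
  moreover have "t i \<in> V i" using assms transversal_in by blast
  ultimately show "t i = u \<and> t j = v"
    using assms parts_disjoint by metis
qed auto

lemma edge_in_transversal_iff_pair:
  assumes "t \<in> transversals" "p \<in> [I]\<^bsup>2\<^esup>" "e \<in> pair_edges p"
  shows "e \<subseteq> t ` (I - {k}) \<longleftrightarrow> t ` p = e \<and> k \<notin> p"
proof -
  obtain i j where p: "p = {i, j}" "i \<in> I" "j \<in> I" "i \<noteq> j"
    using assms(2) by (auto simp: nsets_def card_2_iff)
  obtain u v where "u \<in> V i" "v \<in> V j" "e = {u, v}"
    using assms(3) p pair_edgesE by metis
  then show ?thesis
    using edge_in_transversal_iff[of t i j u v k] image_pair_eq_iff[of t i j u v] assms(1) p by auto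
qed

section \<open>Counting transversals\<close>

text \<open>
  Resampling the coordinate \<open>l\<close> of a uniformly random \<open>t\<close> does not change its distribution, and
  conditionally on the other coordinates the bad event has probability at most \<open>c\<close>. Counting-wise,
  \<open>(t, x)\<close> and \<open>(t(l := x), t l)\<close> correspond bijectively. The family \<open>A\<close> allows some
  coordinates to be pinned to single vertices.
\<close>
lemma bad_fraction:
  assumes A: "\<And>i. i \<in> I \<Longrightarrow> A i \<subseteq> V i" and l: "l \<in> I" "A l = V l"
    and bad: "\<And>t. t \<in> PiE I A \<Longrightarrow> real (card {x \<in> V l. P (t(l := x))}) \<le> c * real n"
  shows "real (card {t \<in> PiE I A. P t}) \<le> c * real (card (PiE I A))"
proof -
  let ?T = "PiE I A"
  have fin: "finite ?T" using A finite_V by (intro finite_PiE) (auto intro: finite_subset)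
  have finV: "finite (V l)" using l finite_V by auto
  define S1 where "S1 = (SIGMA t:?T. {x \<in> V l. P (t(l := x))})"
  define S2 where "S2 = {t \<in> ?T. P t} \<times> V l"
  have "bij_betw (\<lambda>(t, x). (t(l := x), t l)) S1 S2"
    by (rule bij_betw_byWitness[where f' = "\<lambda>(t, x). (t(l := x), t l)"])
       (use l in \<open>auto simp: S1_def S2_def PiE_iff extensional_def fun_upd_idem\<close>)
  then have "card S1 = card S2" by (rule bij_betw_same_card)
  also have "card S2 = card {t \<in> ?T. P t} * n"
    using card_V l by (simp add: S2_def card_cartesian_product)
  finally have "real (card {t \<in> ?T. P t}) * real n = real (card S1)" by simp
  also have "card S1 = (\<Sum>t\<in>?T. card {x \<in> V l. P (t(l := x))})"
    unfolding S1_def using fin finV by (subst card_SigmaI) auto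
  also have "real \<dots> \<le> (\<Sum>t\<in>?T. c * real n)"
    unfolding of_nat_sum by (intro sum_mono bad)
  also have "\<dots> = c * real (card ?T) * real n" by simp
  finally show ?thesis using n_pos by simp
qed

lemma nonadjacent_fraction:
  assumes A: "\<And>i. i \<in> I \<Longrightarrow> A i \<subseteq> V i" and l: "l \<in> I" "m \<in> I" "m \<noteq> l" "A l = V l"
  shows "real (card {t \<in> PiE I A. t ` {l, m} \<notin> edges G}) \<le> c * real (card (PiE I A))"
proof (rule bad_fraction[OF A l(1,4)])
  fix t assume "t \<in> PiE I A"
  then have "t m \<in> V m" using A l by auto
  then have "t m \<in> verts G - V l" using l parts_disjoint by (auto simp: verts_eq)
  from few_nonneighbours[OF _ this] l
  show "real (card {x \<in> V l. (t(l := x)) ` {l, m} \<notin> edges G}) \<le> c * real n"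
    by (simp add: I_def insert_commute)
qed auto

lemma c_bounds: "0 < c" "c \<le> 1 / 81"
proof -
  have s: "real s \<ge> 3" using s_ge by simp
  have "27 * 1 \<le> real s ^ 3 * (real s - 2) ^ 2"
    using power_mono[OF s, of 3] power_mono[of 1 "real s - 2" 2] s
    by (intro mult_mono) auto
  then show "0 < c" "c \<le> 1 / 81"
    unfolding c_eq by (auto simp: field_simps)
qed

lemma card_PiE_pinned:
  assumes "i \<in> I" "j \<in> I" "i \<noteq> j" "u \<in> V i" "v \<in> V j"
  shows "{t \<in> transversals. t i = u \<and> t j = v} = PiE I (V(i := {u}, j := {v}))"
    and "card (PiE I (V(i := {u}, j := {v}))) = n ^ (s - 1)"
proof -
  show "{t \<in> transversals. t i = u \<and> t j = v} = PiE I (V(i := {u}, j := {v}))"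
  proof (intro set_eqI iffI)
    fix t assume "t \<in> PiE I (V(i := {u}, j := {v}))"
    then have t: "\<And>l. l \<in> I \<Longrightarrow> t l \<in> (V(i := {u}, j := {v})) l" and ext: "t \<in> extensional I"
      by (simp_all add: PiE_iff)
    have uv: "t i = u" "t j = v" using t[OF assms(1)] t[OF assms(2)] assms(3) by auto
    have "t l \<in> V l" if "l \<in> I" for l
      using t[OF that] assms by (auto split: if_splits)
    with uv ext show "t \<in> {t \<in> transversals. t i = u \<and> t j = v}"
      by (simp add: transversals_def PiE_iff)
  qed (auto simp: transversals_def PiE_iff)
  have "card (PiE I (V(i := {u}, j := {v}))) = (\<Prod>l\<in>I. card ((V(i := {u}, j := {v})) l))"
    by (simp add: card_PiE)
  also have "\<dots> = (\<Prod>l\<in>I - {i, j}. card ((V(i := {u}, j := {v})) l))"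
    by (rule prod.mono_neutral_right) (use assms in auto)
  also have "\<dots> = (\<Prod>l\<in>I - {i, j}. n)"
    by (rule prod.cong) (auto simp: card_V)
  also have "\<dots> = n ^ (s - 1)"
    using assms by (simp add: card_Diff_subset)
  finally show "card (PiE I (V(i := {u}, j := {v}))) = n ^ (s - 1)" .
qed

lemma card_transversals: "card transversals = n ^ (s + 1)"
  by (simp add: transversals_def card_PiE card_V)

text \<open>
  A union bound over the pairs of coordinates in \<open>J\<close>: the pair \<open>{i, j}\<close> is good by assumption,
  and every other pair has a coordinate that is not pinned, which can be resampled.
\<close>
lemma pinned_incomplete:
  assumes "i \<in> I" "j \<in> I" "i \<noteq> j" "u \<in> V i" "v \<in> V j" "{u, v} \<in> edges G" "J \<subseteq> I" "i \<in> J" "j \<in> J"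
  shows "real (card {t \<in> transversals. t i = u \<and> t j = v \<and> \<not> complete_on t J})
           \<le> real ((card J choose 2) - 1) * c * real n ^ (s - 1)"
proof -
  let ?A = "V(i := {u}, j := {v})"
  let ?P = "[J]\<^bsup>2\<^esup> - {{i, j}}"
  have finJ: "finite J" using assms(7) finite_I finite_subset by blast
  have "{t \<in> transversals. t i = u \<and> t j = v \<and> \<not> complete_on t J} \<subseteq>
     (\<Union>p\<in>?P. {t \<in> PiE I ?A. t ` p \<notin> edges G})"
    (is "?L \<subseteq> _")
  proof
    fix t assume "t \<in> ?L"
    then have t: "t \<in> PiE I ?A" "t i = u" "t j = v" "\<not> complete_on t J"
      using card_PiE_pinned(1)[OF assms(1-5)] by auto
    then obtain p where "p \<in> [J]\<^bsup>2\<^esup>" "t ` p \<notin> edges G" by (auto simp: complete_on_def)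
    moreover from this have "p \<noteq> {i, j}" using assms t by auto
    ultimately show "t \<in> (\<Union>p\<in>?P. {t \<in> PiE I ?A. t ` p \<notin> edges G})" using t by blast
  qed
  moreover have finP: "finite ?P" using finJ by (simp add: finite_imp_finite_nsets)
  moreover have fin: "finite (PiE I ?A)"
    by (intro finite_PiE) (auto intro: finite_V)
  ultimately have "card ?L \<le> card (\<Union>p\<in>?P. {t \<in> PiE I ?A. t ` p \<notin> edges G})"
    by (intro card_mono) auto
  also have "\<dots> \<le> (\<Sum>p\<in>?P. card {t \<in> PiE I ?A. t ` p \<notin> edges G})"
    by (rule card_UN_le[OF finP])
  finally have "real (card ?L) \<le> (\<Sum>p\<in>?P. real (card {t \<in> PiE I ?A. t ` p \<notin> edges G}))"
    unfolding of_nat_sum[symmetric] of_nat_le_iff .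
  also have "\<dots> \<le> (\<Sum>p\<in>?P. c * real n ^ (s - 1))"
  proof (rule sum_mono)
    fix p assume p: "p \<in> ?P"
    then obtain a b where "p = {a, b}" "a \<noteq> b" "a \<in> I" "b \<in> I"
      using assms by (auto simp: nsets_def card_2_iff)
    moreover have "\<not> (a \<in> {i, j} \<and> b \<in> {i, j})"
      using p calculation by auto
    ultimately obtain l m where lm: "p = {l, m}" "m \<noteq> l" "l \<in> I" "m \<in> I" "l \<notin> {i, j}"
      by (cases "a \<in> {i, j}") (auto simp: insert_commute)
    have "real (card {t \<in> PiE I ?A. t ` {l, m} \<notin> edges G}) \<le> c * real (card (PiE I ?A))"
      by (rule nonadjacent_fraction) (use assms lm in auto)
    then show "real (card {t \<in> PiE I ?A. t ` p \<notin> edges G}) \<le> c * real n ^ (s - 1)"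
      using card_PiE_pinned(2)[OF assms(1-5)] lm by simp
  qed
  also have "\<dots> = real (card ?P) * c * real n ^ (s - 1)" by simp
  also have "card ?P = (card J choose 2) - 1"
    using finJ assms by (subst card_Diff_subset) (auto simp: nsets_def card_nsets[unfolded nsets_def])
  finally show ?thesis .
qed

text \<open>
  The number of bad events in the two union bounds: \<open>(s choose 2) - 1\<close> for completing an edge to a
  clique on \<open>s\<close> parts, and \<open>(s + 1 choose 2) - 1 + (s - 1)\<close> for completing two edges \<open>uv\<close>, \<open>u'v\<close> to a pair of
  \<open>(s + 1)\<close>-cliques that differ only in \<open>u\<close> and \<open>u'\<close>.
\<close>
definition "clique_loss = (real s - 2) * (real s + 1) / 2"
definition "swap_loss = (real s - 1) * (real s + 4) / 2"

definition cliques_through :: "nat \<Rightarrow> 'a set \<Rightarrow> (nat \<Rightarrow> 'a) set" where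
  "cliques_through k e = {t \<in> transversals. complete_on t (I - {k}) \<and> e \<subseteq> t ` (I - {k})}"

lemma card_cliques_through:
  assumes "i \<in> I" "j \<in> I" "i \<noteq> j" "u \<in> V i" "v \<in> V j" "{u, v} \<in> edges G" "k \<in> I" "k \<notin> {i, j}"
  shows "real (card (cliques_through k {u, v})) \<ge> (1 - clique_loss * c) * real n ^ (s - 1)"
    and "real (card (cliques_through k {u, v})) \<le> real n ^ (s - 1)"
proof -
  let ?A = "{t \<in> transversals. t i = u \<and> t j = v}"
  let ?B = "{t \<in> transversals. t i = u \<and> t j = v \<and> \<not> complete_on t (I - {k})}"
  have eq: "cliques_through k {u, v} = ?A - ?B"
    using edge_in_transversal_iff[OF _ assms(1-5)] assms(8) by (auto simp: cliques_through_def)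
  have cA: "card ?A = n ^ (s - 1)" using card_PiE_pinned[OF assms(1-5)] by simp
  have "card ?A = card ?B + card (?A - ?B)"
    by (subst card_Un_disjoint[symmetric]) (auto intro!: arg_cong[where f = card])
  then have *: "real (card (cliques_through k {u, v})) = real n ^ (s - 1) - real (card ?B)"
    using eq cA by (simp flip: of_nat_power)
  have "real (card ?B) \<le> real ((card (I - {k}) choose 2) - 1) * c * real n ^ (s - 1)"
    by (rule pinned_incomplete[OF assms(1-6)]) (use assms in auto)
  also have "real ((card (I - {k}) choose 2) - 1) = clique_loss"
    using assms s_ge choose_two_minus_one[of s] by (simp add: clique_loss_def field_simps)
  finally show "real (card (cliques_through k {u, v})) \<ge> (1 - clique_loss * c) * real n ^ (s - 1)"
    using * by (simp add: algebra_simps)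
  show "real (card (cliques_through k {u, v})) \<le> real n ^ (s - 1)" using * by simp
qed

definition swappable :: "nat \<Rightarrow> nat \<Rightarrow> 'a \<Rightarrow> 'a \<Rightarrow> 'a \<Rightarrow> (nat \<Rightarrow> 'a) set" where
  "swappable i j u u' v = {t \<in> transversals. t i = u \<and> t j = v \<and>
     complete_on t I \<and> complete_on (t(i := u')) I}"

lemma card_swappable:
  assumes "i \<in> I" "j \<in> I" "i \<noteq> j" "u \<in> V i" "u' \<in> V i" "v \<in> V j" "{u, v} \<in> edges G" "{u', v} \<in> edges G"
  shows "real (card (swappable i j u u' v)) \<ge> (1 - swap_loss * c) * real n ^ (s - 1)"
proof -
  let ?A = "{t \<in> transversals. t i = u \<and> t j = v}"
  let ?B = "{t \<in> transversals. t i = u \<and> t j = v \<and> \<not> complete_on t I}"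
  let ?F = "V(i := {u}, j := {v})"
  let ?C = "\<lambda>l. {t \<in> PiE I ?F. {t l, u'} \<notin> edges G}"
  have pin: "?A = PiE I ?F" "card (PiE I ?F) = n ^ (s - 1)"
    using card_PiE_pinned[OF assms(1-4,6)] by simp_all
  \<comment> \<open>A pinned \<open>t\<close> that is not swappable has a missing edge, or \<open>u'\<close> misses one of the coordinates other than \<open>i\<close> and \<open>j\<close>.\<close>
  have sub: "?A \<subseteq> swappable i j u u' v \<union> (?B \<union> (\<Union>l\<in>I - {i, j}. ?C l))"
  proof
    fix t assume t: "t \<in> ?A"
    show "t \<in> swappable i j u u' v \<union> (?B \<union> (\<Union>l\<in>I - {i, j}. ?C l))"
    proof (rule ccontr)
      assume n: "\<not> ?thesis"
      with t have comp: "complete_on t I" by auto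
      have adj: "{t l, u'} \<in> edges G" if "l \<in> I - {i, j}" for l
        using n that t pin by blast
      have "complete_on (t(i := u')) I"
        unfolding complete_on_def
      proof
        fix p assume p: "p \<in> [I]\<^bsup>2\<^esup>"
        show "(t(i := u')) ` p \<in> edges G"
        proof (cases "i \<in> p")
          case False
          then have "(t(i := u')) ` p = t ` p" by (intro image_cong) auto
          then show ?thesis using comp p by (auto simp: complete_on_def)
        next
          case True
          then obtain l where l: "p = {i, l}" "l \<noteq> i" "l \<in> I"
            using p by (auto simp: nsets_def card_2_iff)
          show ?thesis
          proof (cases "l = j")
            case True then show ?thesis using l t assms by (simp add: insert_commute)
          next
            case False then show ?thesis using l adj[of l] by (simp add: insert_commute)
          qed
        qed
      qed
      then show False using n t comp by (auto simp: swappable_def)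
    qed
  qed
  have fin: "finite (swappable i j u u' v)" "finite ?B" "\<And>l. finite (?C l)"
    by (auto simp: swappable_def pin(1)[symmetric])
  have "card ?A \<le> card (swappable i j u u' v \<union> (?B \<union> (\<Union>l\<in>I - {i, j}. ?C l)))"
    using fin sub by (intro card_mono) auto
  also have "\<dots> \<le> card (swappable i j u u' v) + (card ?B + card (\<Union>l\<in>I - {i, j}. ?C l))"
    by (meson card_Un_le add_left_mono order_trans)
  also have "card (\<Union>l\<in>I - {i, j}. ?C l) \<le> (\<Sum>l\<in>I - {i, j}. card (?C l))"
    by (rule card_UN_le) auto
  finally have 1: "real n ^ (s - 1) \<le> real (card (swappable i j u u' v)) + real (card ?B)
      + (\<Sum>l\<in>I - {i, j}. real (card (?C l)))"
    using pin by (simp add: of_nat_sum[symmetric] of_nat_add[symmetric] of_nat_power[symmetric] 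
        del: of_nat_sum of_nat_add of_nat_power)
  have "(\<Sum>l\<in>I - {i, j}. real (card (?C l))) \<le> (\<Sum>l\<in>I - {i, j}. c * real n ^ (s - 1))"
  proof (rule sum_mono)
    fix l assume l: "l \<in> I - {i, j}"
    have "real (card (?C l)) \<le> c * real (card (PiE I ?F))"
    proof (rule bad_fraction[where l = l])
      have "u' \<in> verts G - V l" using assms l parts_disjoint by (auto simp: verts_eq)
      from few_nonneighbours[OF _ this]
      show "real (card {x \<in> V l. {(t(l := x)) l, u'} \<notin> edges G}) \<le> c * real n" for t :: "nat \<Rightarrow> 'a"
        using l by (simp add: I_def)
    qed (use assms l in auto)
    then show "real (card (?C l)) \<le> c * real n ^ (s - 1)" using pin by simp
  qed
  also have "\<dots> = (real s - 1) * c * real n ^ (s - 1)"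
    using assms s_ge by (simp add: card_Diff_subset of_nat_diff)
  finally have 2: "(\<Sum>l\<in>I - {i, j}. real (card (?C l))) \<le> (real s - 1) * c * real n ^ (s - 1)" .
  have 3: "real (card ?B) \<le> real ((card I choose 2) - 1) * c * real n ^ (s - 1)"
    by (rule pinned_incomplete) (use assms in auto)
  have 4: "real ((card I choose 2) - 1) + (real s - 1) = swap_loss"
    using choose_two_minus_one[of "s + 1"] s_ge by (simp add: swap_loss_def field_simps)
  have 5: "real ((card I choose 2) - 1) * c * real n ^ (s - 1) + (real s - 1) * c * real n ^ (s - 1)
     = swap_loss * c * real n ^ (s - 1)"
    by (simp only: distrib_right[symmetric] 4)
  show ?thesis using 1 2 3 5 by (simp add: algebra_simps)
qed


section \<open>Numerical consequences of the bound on c\<close>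

lemma scaled_c: "a \<le> q * (3 * (real s ^ 3 * (real s - 2) ^ 2)) \<Longrightarrow> a * c \<le> q"
proof -
  assume a: "a \<le> q * (3 * (real s ^ 3 * (real s - 2) ^ 2))"
  have "0 < real s" "0 < real s - 2" using s_ge by auto
  then have "0 < real s ^ 3 * (real s - 2) ^ 2" by (intro mult_pos_pos) auto
  then show ?thesis using a by (simp add: c_eq field_simps)
qed

text \<open>
  Every upper bound is attained at \<open>s = 3\<close>, where \<open>c = 1 / 81\<close>; the left-hand sides decrease in \<open>s\<close>,
  as \<open>1 / c\<close> grows like the fifth power of \<open>s\<close>.
\<close>
lemma loss_bounds:
  shows "0 \<le> clique_loss * c" and "clique_loss * c \<le> 2 / 81" and "0 \<le> swap_loss * c" and "swap_loss * c \<le> 7 / 81"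
    and "(real s + 1) * c \<le> 4 / 81"
    and "real s * (3 * real s - 5) / 2 * (clique_loss * c) \<le> 4 / 27"
proof -
  define x where "x = real s"
  have x: "x \<ge> 3" using s_ge by (simp add: x_def)
  let ?P = "x ^ 3 * (x - 2) ^ 2"
  have sq: "9 \<le> x\<^sup>2" using power_mono[OF x, of 2] by simp
  have P1: "9 * (x * (x - 2)) \<le> ?P"
  proof -
    have "9 * 1 \<le> x\<^sup>2 * (x - 2)" using sq x by (intro mult_mono) auto
    then have "(9 * 1) * (x * (x - 2)) \<le> (x\<^sup>2 * (x - 2)) * (x * (x - 2))"
      using x by (intro mult_right_mono) auto
    then show ?thesis by (simp add: power2_eq_square power3_eq_cube algebra_simps)
  qed
  have x1: "x \<le> x * (x - 2)" using x mult_left_mono[of 1 "x - 2" x] by simp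
  show "0 \<le> clique_loss * c" "0 \<le> swap_loss * c"
    using c_bounds s_ge by (auto simp: clique_loss_def swap_loss_def)
  have "(x - 2) * (x + 1) \<le> (x - 2) * (4 / 3 * x)"
    using x by (intro mult_left_mono) auto
  then have "clique_loss \<le> 2 / 81 * (3 * ?P)" using P1 by (simp add: clique_loss_def x_def algebra_simps)
  then show "clique_loss * c \<le> 2 / 81" unfolding x_def by (rule scaled_c)
  have "(x - 1) * (x + 4) \<le> (2 * (x - 2)) * (7 / 3 * x)"
    using x by (intro mult_mono) auto
  then have "swap_loss \<le> 7 / 81 * (3 * ?P)" using P1 by (simp add: swap_loss_def x_def algebra_simps)
  then show "swap_loss * c \<le> 7 / 81" unfolding x_def by (rule scaled_c)
  have "x + 1 \<le> 4 / 81 * (3 * ?P)" using P1 x1 x by linarith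
  then show "(real s + 1) * c \<le> 4 / 81" unfolding x_def by (rule scaled_c)
  have "x * (3 * x - 5) / 2 * clique_loss \<le> 4 / 27 * (3 * ?P)"
  proof -
    have "(3 * x - 5) * (x + 1) \<le> (4 * (x - 2)) * (4 / 3 * x)"
      using x by (intro mult_mono) auto
    also have "\<dots> = 16 / 9 * (3 * (x * (x - 2)))" by simp
    also have "\<dots> \<le> 16 / 9 * (x * (x * (x - 2)))"
      using x by (intro mult_left_mono mult_right_mono) auto
    finally have "(3 * x - 5) * (x + 1) \<le> 16 / 9 * (x * (x * (x - 2)))" .
    then have "((3 * x - 5) * (x + 1)) * (x * (x - 2) / 4) \<le> 16 / 9 * (x * (x * (x - 2))) * (x * (x - 2) / 4)"
      using x by (intro mult_right_mono) auto
    moreover have "x * (3 * x - 5) / 2 * clique_loss = ((3 * x - 5) * (x + 1)) * (x * (x - 2) / 4)"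
      by (simp add: clique_loss_def x_def)
    moreover have "16 / 9 * (x * (x * (x - 2))) * (x * (x - 2) / 4) = 4 / 27 * (3 * ?P)"
      by (simp add: power2_eq_square power3_eq_cube)
    ultimately show ?thesis by linarith
  qed
  then show "real s * (3 * real s - 5) / 2 * (clique_loss * c) \<le> 4 / 27"
    using scaled_c unfolding x_def by (metis mult.assoc)
qed

section \<open>Shifting load between edges\<close>

definition load :: "((nat \<Rightarrow> 'a) \<Rightarrow> nat \<Rightarrow> real) \<Rightarrow> 'a set \<Rightarrow> real" where
  "load \<omega> e = (\<Sum>t\<in>transversals. \<Sum>k\<in>I. of_bool (e \<subseteq> t ` (I - {k})) * \<omega> t k)"

text \<open>
  The load change \<open>y\<close> can be produced by signed weights on cliques whose absolute values are
  bounded by \<open>b\<close>. Tracking the bound pointwise lets corrections be superposed (\<open>correctable_sum\<close>) and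
  compared with the initial weights at the very end.
\<close>
definition correctable :: "('a set \<Rightarrow> real) \<Rightarrow> ((nat \<Rightarrow> 'a) \<Rightarrow> nat \<Rightarrow> real) \<Rightarrow> bool" where
  "correctable y b \<longleftrightarrow> (\<exists>\<omega>.
     (\<forall>t\<in>transversals. \<forall>k\<in>I. \<bar>\<omega> t k\<bar> \<le> b t k \<and> (\<omega> t k \<noteq> 0 \<longrightarrow> complete_on t (I - {k}))) \<and>
     (\<forall>e\<in>edges G. load \<omega> e = y e))"

lemma correctable_mono:
  assumes "correctable y b" "\<And>e. e \<in> edges G \<Longrightarrow> y e = y' e"
    and "\<And>t k. t \<in> transversals \<Longrightarrow> k \<in> I \<Longrightarrow> b t k \<le> b' t k"
  shows "correctable y' b'"
proof -
  obtain \<omega> where "\<forall>t\<in>transversals. \<forall>k\<in>I. \<bar>\<omega> t k\<bar> \<le> b t k \<and> (\<omega> t k \<noteq> 0 \<longrightarrow> complete_on t (I - {k}))"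
    "\<forall>e\<in>edges G. load \<omega> e = y e"
    using assms(1) unfolding correctable_def by blast
  then show ?thesis
    unfolding correctable_def using assms(2,3) by (intro exI[of _ \<omega>]) force
qed

lemma load_sum: "load (\<lambda>t k. \<Sum>q\<in>Q. a q * \<omega> q t k) e = (\<Sum>q\<in>Q. a q * load (\<omega> q) e)"
proof -
  have "load (\<lambda>t k. \<Sum>q\<in>Q. a q * \<omega> q t k) e =
     (\<Sum>t\<in>transversals. \<Sum>k\<in>I. \<Sum>q\<in>Q. of_bool (e \<subseteq> t ` (I - {k})) * (a q * \<omega> q t k))"
    by (simp add: load_def sum_distrib_left)
  also have "\<dots> = (\<Sum>t\<in>transversals. \<Sum>q\<in>Q. \<Sum>k\<in>I. of_bool (e \<subseteq> t ` (I - {k})) * (a q * \<omega> q t k))"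
    by (rule sum.cong[OF refl], rule sum.swap)
  also have "\<dots> = (\<Sum>q\<in>Q. \<Sum>t\<in>transversals. \<Sum>k\<in>I. of_bool (e \<subseteq> t ` (I - {k})) * (a q * \<omega> q t k))"
    by (rule sum.swap)
  also have "\<dots> = (\<Sum>q\<in>Q. a q * load (\<omega> q) e)"
    unfolding load_def sum_distrib_left by (intro sum.cong refl mult.left_commute)
  finally show ?thesis .
qed

lemma correctable_sum:
  assumes "\<And>q. q \<in> Q \<Longrightarrow> correctable (y q) (b q)"
  shows "correctable (\<lambda>e. \<Sum>q\<in>Q. a q * y q e) (\<lambda>t k. \<Sum>q\<in>Q. \<bar>a q\<bar> * b q t k)"
proof -
  have "\<forall>q\<in>Q. \<exists>\<omega>.
     (\<forall>t\<in>transversals. \<forall>k\<in>I. \<bar>\<omega> t k\<bar> \<le> b q t k \<and> (\<omega> t k \<noteq> 0 \<longrightarrow> complete_on t (I - {k}))) \<and>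
     (\<forall>e\<in>edges G. load \<omega> e = y q e)"
    using assms by (auto simp: correctable_def)
  then obtain \<omega> where \<omega>: "\<And>q t k. q \<in> Q \<Longrightarrow> t \<in> transversals \<Longrightarrow> k \<in> I \<Longrightarrow> \<bar>\<omega> q t k\<bar> \<le> b q t k"
    "\<And>q t k. q \<in> Q \<Longrightarrow> t \<in> transversals \<Longrightarrow> k \<in> I \<Longrightarrow> \<omega> q t k \<noteq> 0 \<Longrightarrow> complete_on t (I - {k})"
    "\<And>q e. q \<in> Q \<Longrightarrow> e \<in> edges G \<Longrightarrow> load (\<omega> q) e = y q e"
    by (subst (asm) bchoice_iff) blast
  show ?thesis
    unfolding correctable_def
  proof (intro exI[of _ "\<lambda>t k. \<Sum>q\<in>Q. a q * \<omega> q t k"] conjI ballI impI)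
    fix t k assume tk: "t \<in> transversals" "k \<in> I"
    have "\<bar>\<Sum>q\<in>Q. a q * \<omega> q t k\<bar> \<le> (\<Sum>q\<in>Q. \<bar>a q * \<omega> q t k\<bar>)" by (rule sum_abs)
    also have "\<dots> \<le> (\<Sum>q\<in>Q. \<bar>a q\<bar> * b q t k)"
      using \<omega>(1) tk by (intro sum_mono) (auto simp: abs_mult intro: mult_left_mono)
    finally show "\<bar>\<Sum>q\<in>Q. a q * \<omega> q t k\<bar> \<le> (\<Sum>q\<in>Q. \<bar>a q\<bar> * b q t k)" .
    assume "(\<Sum>q\<in>Q. a q * \<omega> q t k) \<noteq> 0"
    then obtain q where "q \<in> Q" "a q * \<omega> q t k \<noteq> 0"
      by (rule sum.not_neutral_contains_not_neutral)
    then have "q \<in> Q" "\<omega> q t k \<noteq> 0" by auto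
    then show "complete_on t (I - {k})" using \<omega>(2) tk by blast
  qed (use \<omega>(3) in \<open>simp add: load_sum\<close>)
qed

text \<open>
  An upper bound for the coefficient with which the clique missing part \<open>k\<close> enters a swap between the
  parts in \<open>p\<close>, see \<open>correctable_swap\<close>; it is a common bound for both orientations of \<open>p\<close>.
\<close>
definition step_cost :: "nat set \<Rightarrow> nat \<Rightarrow> real" where
  "step_cost p k = (if k \<in> p then (real s - 2) / (real s - 1) else 1 / (real s - 1))"
text \<open>The reciprocal of the lower bound on the number of transversals over which a swap is averaged.\<close>
definition "step_scale = 1 / ((1 - swap_loss * c) * real n ^ (s - 1))"

lemma step_cost_nonneg: "0 \<le> step_cost p k"
  using s_ge by (auto simp: step_cost_def)

lemma step_scale_pos: "0 < step_scale"
  using loss_bounds(4) n_pos by (auto simp: step_scale_def)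

lemma complete_on_subset: "complete_on t J \<Longrightarrow> J' \<subseteq> J \<Longrightarrow> complete_on t J'"
  unfolding complete_on_def using nsets_mono by blast

text \<open>
  For an \<open>(s + 1)\<close>-clique \<open>t\<close> through \<open>u\<close> and \<open>v\<close>, give the sub-clique missing part \<open>k\<close> the weight
  \<open>\<alpha> k\<close>, and its image under \<open>u \<mapsto> u'\<close> the weight \<open>- \<alpha> k\<close>. Edges avoiding part \<open>i\<close> cancel. An edge from
  \<open>u\<close> to part \<open>m\<close> receives the sum of all \<open>\<alpha> k\<close> with \<open>k\<close> distinct from \<open>i\<close> and \<open>m\<close>, which has to be 1 for
  \<open>m = j\<close> and 0 otherwise. With \<open>\<alpha> i = 0\<close> this linear system forces \<open>\<alpha> m = 1 / (s - 1)\<close> for \<open>m\<close> outside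
  \<open>{i, j}\<close> and \<open>\<alpha> j = 1 / (s - 1) - 1\<close>.
\<close>
lemma correctable_swap:
  assumes ij: "i \<in> I" "j \<in> I" "i \<noteq> j"
    and uv: "u \<in> V i" "u' \<in> V i" "v \<in> V j" "{u, v} \<in> edges G" "{u', v} \<in> edges G"
  shows "correctable (\<lambda>e. of_bool (e = {u, v}) - of_bool (e = {u', v}))
    (\<lambda>t k. step_scale * step_cost {i, j} k * (of_bool (t ` {i, j} = {u, v}) + of_bool (t ` {i, j} = {u', v})))"
proof (cases "u = u'")
  case True
  have "0 \<le> step_scale * step_cost {i, j} k" for k
    by (rule mult_nonneg_nonneg[OF less_imp_le[OF step_scale_pos] step_cost_nonneg])
  with True show ?thesis
    unfolding correctable_def by (intro exI[of _ "\<lambda>t k. 0"]) (simp add: load_def)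
next
  case False
  define \<alpha> where "\<alpha> k = (if k = i then 0 else if k = j then - (real s - 2) / (real s - 1) else 1 / (real s - 1))" for k
  define S where "S = swappable i j u u' v"
  \<comment> \<open>the images of the members of \<open>S\<close> under the replacement of \<open>u\<close> by \<open>u'\<close>\<close>
  define S' where "S' = {t \<in> transversals. t i = u' \<and> t(i := u) \<in> S}"
  define \<omega> where "\<omega> t k = \<alpha> k / real (card S) * (of_bool (t \<in> S) - of_bool (t \<in> S'))" for t k
  have finS: "finite S" "S \<subseteq> transversals" "finite S'" "S' \<subseteq> transversals"
    by (auto simp: S_def S'_def swappable_def)
  have cardS: "real (card S) \<ge> 1 / step_scale"
    using card_swappable[OF ij uv] by (simp add: S_def step_scale_def)
  have cardS_pos: "real (card S) > 0"
    using cardS step_scale_pos by (meson divide_pos_pos less_le_trans zero_less_one)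
  have upd: "t(i := w) \<in> transversals" if "t \<in> transversals" "w \<in> V i" for t w
    using that ij by (auto simp: transversals_def PiE_iff extensional_def)
  have S_eq: "t i = u" "t j = v" if "t \<in> S" for t
    using that by (auto simp: S_def swappable_def)
  have bij: "bij_betw (\<lambda>t. t(i := u')) S S'"
  proof (rule bij_betw_byWitness[where f' = "\<lambda>t. t(i := u)"])
    show restore: "\<forall>t\<in>S. (t(i := u'))(i := u) = t" using S_eq by auto
    show "\<forall>t\<in>S'. (t(i := u))(i := u') = t" by (auto simp: S'_def)
    show "(\<lambda>t. t(i := u')) ` S \<subseteq> S'"
    proof (rule image_subsetI)
      fix t assume t: "t \<in> S"
      then have "t(i := u') \<in> transversals" "(t(i := u'))(i := u) \<in> S"
        using upd uv finS restore by auto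
      then show "t(i := u') \<in> S'" unfolding S'_def by simp
    qed
    show "(\<lambda>t. t(i := u)) ` S' \<subseteq> S" unfolding S'_def by blast
  qed
  have S'_eq: "t i = u'" "t j = v" if "t \<in> S'" for t
  proof -
    have "t(i := u) \<in> S" "t i = u'" using that unfolding S'_def by blast+
    with S_eq(2)[of "t(i := u)"] ij show "t i = u'" "t j = v" by simp_all
  qed
  have \<alpha>_sum: "(\<Sum>k\<in>I - {l, m}. \<alpha> k) = 1 / (real s - 1) - \<alpha> l - \<alpha> m"
    if "l \<in> I" "m \<in> I" "l \<noteq> m" for l m
  proof -
    have *: "(\<Sum>k\<in>I. \<alpha> k) = (\<Sum>k\<in>I - {l, m}. \<alpha> k) + (\<alpha> l + \<alpha> m)"
      if "l \<in> I" "m \<in> I" "l \<noteq> m" for l m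
      using that by (subst sum.subset_diff[of "{l, m}"]) auto
    have \<alpha>_i: "\<alpha> i = 0" by (simp add: \<alpha>_def)
    have "(\<Sum>k\<in>I - {i, j}. \<alpha> k) = (\<Sum>k\<in>I - {i, j}. 1 / (real s - 1))"
      by (rule sum.cong) (auto simp: \<alpha>_def)
    also have "\<dots> = real (card (I - {i, j})) * (1 / (real s - 1))" by simp
    also have "card (I - {i, j}) = s - 1" using ij by (subst card_Diff_subset) auto
    also have "real (s - 1) * (1 / (real s - 1)) = 1" using s_ge by (simp add: of_nat_diff)
    finally have "(\<Sum>k\<in>I. \<alpha> k) = 1 + \<alpha> j"
      using *[OF ij] \<alpha>_i by linarith
    also have "\<dots> = 1 / (real s - 1)" using ij s_ge by (simp add: \<alpha>_def field_simps)
    finally show ?thesis using *[OF that] by simp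
  qed
  define g :: "'a set \<Rightarrow> (nat \<Rightarrow> 'a) \<Rightarrow> real" where "g e t = (\<Sum>k\<in>I. of_bool (e \<subseteq> t ` (I - {k})) * \<alpha> k)" for e t
  have g_eq: "g {a, b} t = (if t l = a \<and> t m = b then 1 / (real s - 1) - \<alpha> l - \<alpha> m else 0)"
    if "t \<in> transversals" "l \<in> I" "m \<in> I" "l \<noteq> m" "a \<in> V l" "b \<in> V m" for a b l m t
  proof -
    have "g {a, b} t = (\<Sum>k\<in>I. of_bool (t l = a \<and> t m = b \<and> k \<notin> {l, m}) * \<alpha> k)"
      unfolding g_def by (intro sum.cong refl) (simp only: edge_in_transversal_iff[OF that])
    also have "\<dots> = (if t l = a \<and> t m = b then (\<Sum>k\<in>I - {l, m}. \<alpha> k) else 0)"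
      by (auto intro!: sum.mono_neutral_cong_right)
    finally show ?thesis using \<alpha>_sum that by simp
  qed
  have g_diff: "g e t - g e (t(i := u')) = of_bool (e = {u, v}) - of_bool (e = {u', v})"
    if e: "e \<in> edges G" and t: "t \<in> S" for e t
  proof -
    \<comment> \<open>Order the ends of \<open>e\<close> so that an end in part \<open>i\<close>, if there is one, comes first.\<close>
    obtain l m a b where lm: "l \<in> I" "m \<in> I" "l \<noteq> m" "a \<in> V l" "b \<in> V m" "e = {a, b}"
      and or: "m \<noteq> i"
    proof -
      obtain l m a b where lm: "l \<in> I" "m \<in> I" "l \<noteq> m" "a \<in> V l" "b \<in> V m" "e = {a, b}"
        using e by (rule edge_cases)
      show ?thesis
      proof (cases "m = i")
        case True then show ?thesis using that[of m l b a] lm by (simp add: insert_commute)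
      next
        case False then show ?thesis using that lm by blast
      qed
    qed
    have tt: "t \<in> transversals" "t(i := u') \<in> transversals"
      using t finS upd uv by auto
    note gs = g_eq[OF tt(1) lm(1-5)] g_eq[OF tt(2) lm(1-5)]
    have eq: "{a, b} = {w, v} \<longleftrightarrow> l = i \<and> m = j \<and> a = w \<and> b = v" if "w \<in> V i" for w
      using that lm or uv ij parts_disjoint by (auto simp: doubleton_eq_iff)
    show ?thesis
    proof (cases "l = i")
      case l: True
      show ?thesis
      proof (cases "m = j")
        case True
        have "1 / (real s - 1) - \<alpha> i - \<alpha> j = 1"
          using ij s_ge by (simp add: \<alpha>_def field_simps)
        then show ?thesis
          using gs S_eq[OF t] lm True l eq uv ij by (auto simp: fun_upd_def)
      next
        case m: False
        have "1 / (real s - 1) - \<alpha> i - \<alpha> m = 0"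
          using ij m or by (simp add: \<alpha>_def)
        then show ?thesis using gs lm l m eq uv by simp
      qed
    next
      case False
      then show ?thesis using gs lm or eq uv by simp
    qed
  qed
  show ?thesis
    unfolding correctable_def
  proof (intro exI[of _ \<omega>] conjI ballI impI)
    fix t k assume tk: "t \<in> transversals" "k \<in> I"
    let ?r = "of_bool (t ` {i, j} = {u, v}) + of_bool (t ` {i, j} = {u', v}) :: real"
    have 1: "\<bar>\<alpha> k\<bar> \<le> step_cost {i, j} k" using s_ge by (auto simp: \<alpha>_def step_cost_def)
    have 2: "1 / real (card S) \<le> step_scale"
      using cardS cardS_pos step_scale_pos by (simp add: field_simps)
    have 3: "\<bar>of_bool (t \<in> S) - of_bool (t \<in> S')\<bar> \<le> ?r"
      using S_eq[of t] S'_eq[of t] by auto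
    have "\<bar>\<omega> t k\<bar> = (1 / real (card S)) * \<bar>\<alpha> k\<bar> * \<bar>of_bool (t \<in> S) - of_bool (t \<in> S')\<bar>"
      by (simp add: \<omega>_def abs_mult)
    also have "\<dots> \<le> step_scale * step_cost {i, j} k * ?r"
      using 1 2 3 step_scale_pos step_cost_nonneg by (intro mult_mono) auto
    finally show "\<bar>\<omega> t k\<bar> \<le> step_scale * step_cost {i, j} k * ?r" .
  next
    fix t k assume tk: "t \<in> transversals" "k \<in> I" "\<omega> t k \<noteq> 0"
    then have "t \<in> S \<or> t \<in> S'" by (auto simp: \<omega>_def)
    then have "complete_on t I"
    proof
      assume "t \<in> S'"
      then have "complete_on ((t(i := u))(i := u')) I" "t i = u'"
        by (auto simp: S'_def S_def swappable_def)
      then show ?thesis by (simp add: fun_upd_idem)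
    qed (auto simp: S_def swappable_def)
    then show "complete_on t (I - {k})" by (rule complete_on_subset) auto
  next
    fix e assume e: "e \<in> edges G"
    have "load \<omega> e = (\<Sum>t\<in>transversals. 1 / real (card S) *
        (of_bool (t \<in> S) * g e t - of_bool (t \<in> S') * g e t))"
      unfolding load_def g_def \<omega>_def
      by (intro sum.cong[OF refl], simp only: sum_distrib_left sum_subtractf[symmetric])
         (intro sum.cong refl, simp add: algebra_simps)
    also have "\<dots> = 1 / real (card S) * ((\<Sum>t\<in>transversals. of_bool (t \<in> S) * g e t)
        - (\<Sum>t\<in>transversals. of_bool (t \<in> S') * g e t))"
      by (simp only: sum_distrib_left[symmetric] sum_subtractf)
    also have "(\<Sum>t\<in>transversals. of_bool (t \<in> S) * g e t) = (\<Sum>t\<in>S. g e t)"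
      using finS by (intro sum.mono_neutral_cong_right) auto
    also have "(\<Sum>t\<in>transversals. of_bool (t \<in> S') * g e t) = (\<Sum>t\<in>S'. g e t)"
      using finS by (intro sum.mono_neutral_cong_right) auto
    also have "\<dots> = (\<Sum>t\<in>S. g e (t(i := u')))"
      by (rule sum.reindex_bij_betw[OF bij, symmetric])
    also have "(\<Sum>t\<in>S. g e t) - (\<Sum>t\<in>S. g e (t(i := u'))) = (\<Sum>t\<in>S. g e t - g e (t(i := u')))"
      by (rule sum_subtractf[symmetric])
    also have "\<dots> = (\<Sum>t\<in>S. of_bool (e = {u, v}) - of_bool (e = {u', v}))"
      by (intro sum.cong refl g_diff e)
    finally show "load \<omega> e = of_bool (e = {u, v}) - of_bool (e = {u', v})"
      using cardS_pos by simp
  qed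
qed


lemma correctable_add:
  assumes "correctable y1 b1" "correctable y2 b2"
  shows "correctable (\<lambda>e. y1 e + y2 e) (\<lambda>t k. b1 t k + b2 t k)"
  using correctable_sum[of "{True, False}" "\<lambda>q. if q then y1 else y2" "\<lambda>q. if q then b1 else b2" "\<lambda>_. 1"]
    assms by simp

text \<open>
  For \<open>e = uv\<close> and \<open>e' = u'v'\<close> the route is \<open>uv, xv, xv', u'v'\<close>, averaged over all common neighbours
  \<open>x\<close> of \<open>v\<close> and \<open>v'\<close> in part \<open>i\<close>; there are at least \<open>(1 - 2 c) n\<close> of them. The two intermediate edges take part in two
  swaps each, hence the factor 2. The bound keeps only the end of such an edge in part \<open>j\<close>, since the
  average over \<open>x\<close> spreads its other end over part \<open>i\<close>.
\<close>
lemma correctable_path: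
  assumes ij: "i \<in> I" "j \<in> I" "i \<noteq> j" and e: "e \<in> pair_edges {i, j}" "e' \<in> pair_edges {i, j}"
  shows "correctable (\<lambda>f. of_bool (f = e) - of_bool (f = e'))
    (\<lambda>t k. step_scale * step_cost {i, j} k * (of_bool (t ` {i, j} = e) + of_bool (t ` {i, j} = e')
       + 2 / ((1 - 2 * c) * real n) * (of_bool (t j \<in> e) + of_bool (t j \<in> e'))))"
proof -
  obtain u v where uv: "u \<in> V i" "v \<in> V j" "e = {u, v}" "{u, v} \<in> edges G"
    using e(1) ij by (rule pair_edgesE)
  obtain u' v' where uv': "u' \<in> V i" "v' \<in> V j" "e' = {u', v'}" "{u', v'} \<in> edges G"
    using e(2) ij by (rule pair_edgesE)
  define X where "X = {x \<in> V i. {x, v} \<in> edges G \<and> {x, v'} \<in> edges G}"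
  have finX: "finite X" using finite_V ij by (simp add: X_def)
  let ?N = "\<lambda>v. {x \<in> V i. {x, v} \<notin> edges G}"
  have N: "real (card (?N w)) \<le> c * real n" if "w \<in> V j" for w
  proof -
    have "w \<in> verts G - V i" using that ij parts_disjoint by (auto simp: verts_eq)
    with few_nonneighbours ij show ?thesis unfolding I_def by blast
  qed
  have "V i = X \<union> (?N v \<union> ?N v')" by (auto simp: X_def)
  then have "card (V i) = card (X \<union> (?N v \<union> ?N v'))" by (rule arg_cong)
  with card_Un_le[of X "?N v \<union> ?N v'"] card_Un_le[of "?N v" "?N v'"]
  have "card (V i) \<le> card X + (card (?N v) + card (?N v'))" by linarith
  then have "real n \<le> real (card X) + (real (card (?N v)) + real (card (?N v')))"
    using card_V ij by simp
  then have cardX: "(1 - 2 * c) * real n \<le> real (card X)"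
    using N[OF uv(2)] N[OF uv'(2)] by (simp add: algebra_simps)
  have pos: "0 < (1 - 2 * c) * real n" using c_bounds n_pos by simp
  have cardX_pos: "0 < real (card X)" using cardX pos by linarith
  let ?p = "{i, j}"
  have step: "correctable (\<lambda>f. of_bool (f = e) - of_bool (f = e'))
    (\<lambda>t k. step_scale * step_cost ?p k * (of_bool (t ` ?p = e) + of_bool (t ` ?p = e')
       + 2 * (of_bool (t ` ?p = {x, v}) + of_bool (t ` ?p = {x, v'}))))" if x: "x \<in> X" for x
  proof -
    have xs: "x \<in> V i" "{x, v} \<in> edges G" "{x, v'} \<in> edges G" using x by (auto simp: X_def)
    have ji: "{j, i} = {i, j}" "{v, x} = {x, v}" "{v', x} = {x, v'}" by auto
    have 1: "correctable (\<lambda>f. of_bool (f = {u, v}) - of_bool (f = {x, v}))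
      (\<lambda>t k. step_scale * step_cost ?p k * (of_bool (t ` ?p = {u, v}) + of_bool (t ` ?p = {x, v})))"
      by (rule correctable_swap) (use ij uv xs in auto)
    have 2: "correctable (\<lambda>f. of_bool (f = {x, v}) - of_bool (f = {x, v'}))
      (\<lambda>t k. step_scale * step_cost ?p k * (of_bool (t ` ?p = {x, v}) + of_bool (t ` ?p = {x, v'})))"
      using correctable_swap[of j i v v' x] ij uv uv' xs unfolding ji by auto
    have 3: "correctable (\<lambda>f. of_bool (f = {x, v'}) - of_bool (f = {u', v'}))
      (\<lambda>t k. step_scale * step_cost ?p k * (of_bool (t ` ?p = {x, v'}) + of_bool (t ` ?p = {u', v'})))"
      by (rule correctable_swap) (use ij uv' xs in auto)
    show ?thesis
      by (rule correctable_mono[OF correctable_add[OF correctable_add[OF 1 2] 3]])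
         (simp_all add: uv uv' algebra_simps)
  qed
  show ?thesis
  proof (rule correctable_mono[OF correctable_sum[where a = "\<lambda>_. 1 / real (card X)", OF step]])
    fix t k assume t: "t \<in> transversals" "k \<in> I"
    have hit: "(\<Sum>x\<in>X. of_bool (t ` ?p = {x, w})) \<le> (of_bool (t j \<in> {a, w}) :: real)"
      if w: "w \<in> V j" and a: "a \<in> V i" for a w
    proof -
      have "(\<Sum>x\<in>X. of_bool (t ` ?p = {x, w})) = (\<Sum>x\<in>X. of_bool (x = t i) * of_bool (t j = w) :: real)"
        using image_pair_eq_iff[OF t(1) ij _ w] by (intro sum.cong refl) (auto simp: X_def)
      also have "\<dots> = of_bool (t i \<in> X) * of_bool (t j = w)"
        using finX by (simp add: sum_distrib_right[symmetric])
      also have "\<dots> \<le> of_bool (t j \<in> {a, w})" by simp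
      finally show ?thesis .
    qed
    let ?b = "of_bool (t ` ?p = e) + of_bool (t ` ?p = e') :: real"
    let ?h = "of_bool (t j \<in> e) + of_bool (t j \<in> e') :: real"
    have "(\<Sum>x\<in>X. \<bar>1 / real (card X)\<bar> * (step_scale * step_cost ?p k * (?b
       + 2 * (of_bool (t ` ?p = {x, v}) + of_bool (t ` ?p = {x, v'})))))
      = 1 / real (card X) * (step_scale * step_cost ?p k * (\<Sum>x\<in>X. ?b
       + 2 * (of_bool (t ` ?p = {x, v}) + of_bool (t ` ?p = {x, v'}))))"
      by (simp only: sum_distrib_left abs_of_nonneg[OF divide_nonneg_nonneg[OF zero_le_one of_nat_0_le_iff]])
    also have "\<dots> = step_scale * step_cost ?p k * (?b + 2 / real (card X) *
       ((\<Sum>x\<in>X. of_bool (t ` ?p = {x, v})) + (\<Sum>x\<in>X. of_bool (t ` ?p = {x, v'}))))"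
      using cardX_pos by (simp only: sum.distrib sum_distrib_left[symmetric] sum_constant) (simp add: field_simps)
    also have "\<dots> \<le> step_scale * step_cost ?p k * (?b + 2 / ((1 - 2 * c) * real n) * ?h)"
    proof (intro mult_left_mono add_left_mono mult_mono)
      show "2 / real (card X) \<le> 2 / ((1 - 2 * c) * real n)"
        using cardX pos by (intro divide_left_mono) auto
      show "(\<Sum>x\<in>X. of_bool (t ` ?p = {x, v})) + (\<Sum>x\<in>X. of_bool (t ` ?p = {x, v'})) \<le> ?h"
        using hit uv uv' by (intro add_mono) auto
      show "0 \<le> 2 / ((1 - 2 * c) * real n)" using pos by simp
      show "0 \<le> (\<Sum>x\<in>X. of_bool (t ` ?p = {x, v})) + (\<Sum>x\<in>X. of_bool (t ` ?p = {x, v'}) :: real)"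
        by (intro add_nonneg_nonneg sum_nonneg) auto
      show "0 \<le> step_scale * step_cost ?p k" by (rule mult_nonneg_nonneg[OF less_imp_le[OF step_scale_pos] step_cost_nonneg])
    qed
    finally show "(\<Sum>x\<in>X. \<bar>1 / real (card X)\<bar> * (step_scale * step_cost ?p k * (?b
       + 2 * (of_bool (t ` ?p = {x, v}) + of_bool (t ` ?p = {x, v'})))))
       \<le> step_scale * step_cost ?p k * (?b + 2 / ((1 - 2 * c) * real n) * ?h)" .
  qed (use cardX_pos in auto)
qed

text \<open>
  With \<open>m\<close> the number of edges in \<open>pair_edges p\<close>, a function \<open>y\<close> of sum zero is the sum over all
  ordered pairs of \<open>(y e - y e') / (2 m)\<close> times the unit transfer from \<open>e'\<close> to \<open>e\<close>. A given edge is an end of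
  at most \<open>2 m\<close> of these transfers, which accounts for \<open>R\<close>; a given vertex lies in at
  most \<open>n\<close> of the edges, so the intermediate edges of the routes account for \<open>2 R / (1 - 2 c)\<close>.
\<close>
lemma correctable_pair:
  assumes p: "p \<in> [I]\<^bsup>2\<^esup>" and zero: "(\<Sum>e\<in>pair_edges p. y e) = 0"
    and R: "\<And>e e'. e \<in> pair_edges p \<Longrightarrow> e' \<in> pair_edges p \<Longrightarrow> y e - y e' \<le> R" and "0 \<le> R"
  shows "correctable (\<lambda>f. of_bool (f \<in> pair_edges p) * y f)
    (\<lambda>t k. step_scale * step_cost p k * (R * (1 + 2 / (1 - 2 * c))))"
proof -
  obtain i j where ij: "i \<in> I" "j \<in> I" "i \<noteq> j" "p = {i, j}"
    using p by (auto simp: nsets_def card_2_iff)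
  define E where "E = pair_edges p"
  define m where "m = real (card E)"
  have finE: "finite E" by (simp add: E_def)
  define a where "a q = (y (fst q) - y (snd q)) / (2 * m)" for q
  define K where "K = 2 / ((1 - 2 * c) * real n)"
  have K0: "0 \<le> K" using c_bounds by (simp add: K_def)
  define b :: "'a set \<times> 'a set \<Rightarrow> (nat \<Rightarrow> 'a) \<Rightarrow> nat \<Rightarrow> real" where "b q t k = step_scale * step_cost p k * (of_bool (t ` p = fst q) + of_bool (t ` p = snd q)
       + K * (of_bool (t j \<in> fst q) + of_bool (t j \<in> snd q)))" for q t k
  have path: "correctable (\<lambda>f. of_bool (f = fst q) - of_bool (f = snd q)) (b q)" if "q \<in> E \<times> E" for q
  proof -
    have bq: "b q = (\<lambda>t k. step_scale * step_cost p k * (of_bool (t ` p = fst q) + of_bool (t ` p = snd q)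
       + K * (of_bool (t j \<in> fst q) + of_bool (t j \<in> snd q))))"
      by (intro ext) (simp only: b_def)
    show ?thesis
      unfolding bq K_def ij(4) by (rule correctable_path) (use that ij in \<open>auto simp: E_def\<close>)
  qed
  have abs_a: "\<bar>a q\<bar> \<le> R / (2 * m)" if "q \<in> E \<times> E" for q
  proof -
    have "\<bar>y (fst q) - y (snd q)\<bar> \<le> R" using that R by (force simp: E_def abs_le_iff)
    then show ?thesis by (auto simp: a_def m_def abs_divide intro: divide_right_mono)
  qed
  show ?thesis
  proof (rule correctable_mono[OF correctable_sum[where a = a, OF path]])
    fix f assume "f \<in> edges G"
    let ?y = "\<Sum>q\<in>E \<times> E. a q * (of_bool (f = fst q) - of_bool (f = snd q))"
    have "?y = (\<Sum>e\<in>E. \<Sum>e'\<in>E. a (e, e') * of_bool (f = e)) - (\<Sum>e\<in>E. \<Sum>e'\<in>E. a (e, e') * of_bool (f = e'))"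
      by (simp add: sum.cartesian_product' right_diff_distrib sum_subtractf)
    also have "(\<Sum>e\<in>E. \<Sum>e'\<in>E. a (e, e') * of_bool (f = e)) = of_bool (f \<in> E) * (\<Sum>e'\<in>E. a (f, e'))"
      using finE by (simp add: sum_distrib_right[symmetric] sum.delta')
    also have "(\<Sum>e\<in>E. \<Sum>e'\<in>E. a (e, e') * of_bool (f = e')) = of_bool (f \<in> E) * (\<Sum>e\<in>E. a (e, f))"
      using finE by (simp add: sum_distrib_right[symmetric] sum.delta')
    also have "of_bool (f \<in> E) * (\<Sum>e'\<in>E. a (f, e')) - of_bool (f \<in> E) * (\<Sum>e\<in>E. a (e, f)) = of_bool (f \<in> E) * y f"
    proof (cases "f \<in> E")
      case True
      then have m: "m > 0" using finE by (auto simp: m_def card_gt_0_iff)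
      have z: "(\<Sum>e\<in>E. y e) = 0" using zero by (simp add: E_def)
      have "(\<Sum>e'\<in>E. a (f, e')) = y f / 2"
        using m z by (simp add: a_def sum_divide_distrib[symmetric] sum_subtractf m_def)
      moreover have "(\<Sum>e\<in>E. a (e, f)) = - y f / 2"
        using m z by (simp add: a_def sum_divide_distrib[symmetric] sum_subtractf m_def)
      ultimately show ?thesis using True by simp
    qed auto
    finally show "?y = of_bool (f \<in> pair_edges p) * y f" by (simp add: E_def)
  next
    fix t k assume t: "t \<in> transversals" "k \<in> I"
    have kb: "0 \<le> step_scale * step_cost p k" by (rule mult_nonneg_nonneg[OF less_imp_le[OF step_scale_pos] step_cost_nonneg])
    have tj: "t j \<in> V j" using t ij transversal_in by blast
    have hit: "(\<Sum>e\<in>E. of_bool (t ` p = e)) \<le> (1::real)"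
      unfolding of_bool_def sum.delta'[OF finE] by simp
    have deg: "(\<Sum>e\<in>E. of_bool (t j \<in> e)) \<le> real n"
    proof -
      have "{e \<in> E. t j \<in> e} \<subseteq> (\<lambda>x. {x, t j}) ` V i"
      proof
        fix e assume e: "e \<in> {e \<in> E. t j \<in> e}"
        then obtain u v where "u \<in> V i" "v \<in> V j" "e = {u, v}"
          using ij pair_edgesE unfolding E_def by blast
        moreover from this have "t j = v" using e ij tj parts_disjoint by auto
        ultimately show "e \<in> (\<lambda>x. {x, t j}) ` V i" by auto
      qed
      then have "card {e \<in> E. t j \<in> e} \<le> card (V i)"
        using ij finite_V by (meson card_image_le card_mono finite_imageI order_trans)
      then show ?thesis using ij card_V finE by (simp add: of_bool_def sum.If_cases Int_def)
    qed
    have pairs: "(\<Sum>q\<in>E \<times> E. of_bool (P (fst q)) + of_bool (P (snd q))) = 2 * m * (\<Sum>e\<in>E. of_bool (P e) :: real)" for P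
      by (simp add: sum.cartesian_product' sum.distrib m_def sum_distrib_left mult.assoc del: sum_of_bool_eq)
    have "(\<Sum>q\<in>E \<times> E. \<bar>a q\<bar> * b q t k) \<le> (\<Sum>q\<in>E \<times> E. R / (2 * m) * b q t k)"
    proof (intro sum_mono mult_right_mono abs_a)
      show "0 \<le> b q t k" for q unfolding b_def
        by (rule mult_nonneg_nonneg[OF kb]) (use K0 in auto)
    qed
    also have "\<dots> = R / (2 * m) * (step_scale * step_cost p k * ((\<Sum>q\<in>E \<times> E. of_bool (t ` p = fst q) + of_bool (t ` p = snd q))
         + K * (\<Sum>q\<in>E \<times> E. of_bool (t j \<in> fst q) + of_bool (t j \<in> snd q))))"
      unfolding b_def by (simp only: sum_distrib_left[symmetric] sum.distrib)
    also have "\<dots> = R / (2 * m) * (step_scale * step_cost p k * (2 * m * (\<Sum>e\<in>E. of_bool (t ` p = e)) + K * (2 * m * (\<Sum>e\<in>E. of_bool (t j \<in> e)))))"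
      by (simp only: pairs)
    also have "\<dots> \<le> R / (2 * m) * (step_scale * step_cost p k * (2 * m * 1 + K * (2 * m * real n)))"
      using hit deg kb K0 \<open>0 \<le> R\<close>
      by (intro mult_left_mono add_mono) (auto simp: m_def)
    also have "\<dots> \<le> step_scale * step_cost p k * (R * (1 + 2 / (1 - 2 * c)))"
    proof (cases "m = 0")
      case True
      then show ?thesis using kb \<open>0 \<le> R\<close> c_bounds by (auto intro!: mult_nonneg_nonneg add_nonneg_nonneg)
    next
      case False
      have "K * real n = 2 / (1 - 2 * c)" using n_pos by (simp add: K_def)
      moreover have "R / (2 * m) * (step_scale * step_cost p k * (2 * m * 1 + K * (2 * m * real n)))
         = step_scale * step_cost p k * (R * (1 + K * real n))"
        using False by (simp add: field_simps)
      ultimately show ?thesis by simp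
    qed
    finally show "(\<Sum>q\<in>E \<times> E. \<bar>a q\<bar> * b q t k) \<le> step_scale * step_cost p k * (R * (1 + 2 / (1 - 2 * c)))" .
  qed
qed


section \<open>Sizes of the bipartite graphs between the parts\<close>

definition "part_deg i = real (part_degree (s + 1) V G i)"
definition "total_weight = real (card (edges G)) / real (s choose 2)"
text \<open>
  In a fractional decomposition this is the total weight of the copies that miss part \<open>k\<close>: every copy
  meeting part \<open>k\<close> uses \<open>s - 1\<close> of the edges there.
\<close>
definition "missing_weight k = total_weight - part_deg k / (real s - 1)"

lemma card_pair_edges_admissible:
  assumes "i \<in> I" "j \<in> I" "i \<noteq> j"
  shows "real (card (pair_edges {i, j})) = (part_deg i + part_deg j) / (real s - 1) - total_weight"
proof -
  have less: "real (card (pair_edges {i, j})) = (part_deg i + part_deg j) / (real s - 1) - total_weight"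
    if "i \<in> I" "j \<in> I" "i < j" for i j
    using admissible that pair_edges_eq[of i j] by (auto simp: admissible_def part_deg_def total_weight_def I_def)
  show ?thesis
  proof (cases "i < j")
    case False
    then show ?thesis using less[of j i] assms by (simp add: insert_commute add.commute)
  qed (use less assms in blast)
qed

lemma part_deg_eq: "i \<in> I \<Longrightarrow> part_deg i = (\<Sum>j\<in>I - {i}. real (card (pair_edges {i, j})))"
  unfolding part_deg_def part_degree_def of_nat_sum
  by (rule sum.cong) (auto simp: pair_edges_eq I_def)

lemma card_pair_edges_bounds:
  assumes "i \<in> I" "j \<in> I" "i \<noteq> j"
  shows "real (card (pair_edges {i, j})) \<le> real n ^ 2"
    and "(1 - c) * real n ^ 2 \<le> real (card (pair_edges {i, j}))"
proof -
  let ?N = "\<lambda>v. {x \<in> V i. {x, v} \<in> edges G}"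
  let ?D = "\<lambda>v. {x \<in> V i. {x, v} \<notin> edges G}"
  have "bij_betw (\<lambda>(v, u). {u, v}) (SIGMA v:V j. ?N v) (pair_edges {i, j})"
  proof (rule bij_betw_imageI)
    show "inj_on (\<lambda>(v, u). {u, v}) (SIGMA v:V j. ?N v)"
      using assms parts_disjoint by (auto simp: inj_on_def doubleton_eq_iff)
    show "(\<lambda>(v, u). {u, v}) ` (SIGMA v:V j. ?N v) = pair_edges {i, j}"
      using assms by (auto simp: pair_edges_eq edges_between_def)
  qed
  then have "card (pair_edges {i, j}) = card (SIGMA v:V j. ?N v)"
    by (rule bij_betw_same_card[symmetric])
  also have "\<dots> = (\<Sum>v\<in>V j. card (?N v))"
    using assms finite_V by (subst card_SigmaI) auto
  finally have card: "real (card (pair_edges {i, j})) = (\<Sum>v\<in>V j. real (card (?N v)))"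
    by simp
  have Nle: "real (card (?N v)) \<le> real n" for v
    using card_mono[of "V i" "?N v"] finite_V card_V assms by auto
  have "(\<Sum>v\<in>V j. real (card (?N v))) \<le> (\<Sum>v\<in>V j. real n)" by (intro sum_mono Nle)
  then show "real (card (pair_edges {i, j})) \<le> real n ^ 2"
    using card card_V assms by (simp add: power2_eq_square)
  have Nge: "(1 - c) * real n \<le> real (card (?N v))" if "v \<in> V j" for v
  proof -
    have "v \<in> verts G - V i" using that assms parts_disjoint by (auto simp: verts_eq)
    then have "real (card (?D v)) \<le> c * real n" using few_nonneighbours assms unfolding I_def by blast
    moreover have "card (V i) = card (?N v) + card (?D v)"
      using finite_V assms by (subst card_Un_disjoint[symmetric]) (auto intro!: arg_cong[where f = card])
    ultimately show ?thesis using card_V assms by (simp add: algebra_simps)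
  qed
  have "(\<Sum>v\<in>V j. (1 - c) * real n) \<le> (\<Sum>v\<in>V j. real (card (?N v)))" by (intro sum_mono Nge)
  then show "(1 - c) * real n ^ 2 \<le> real (card (pair_edges {i, j}))"
    using card card_V assms by (simp add: power2_eq_square algebra_simps)
qed

text \<open>
  This is the handshake identity in disguise, but admissibility alone yields it: substituting the
  prescribed edge counts into the definition of the degree sum of a single part cancels
  that sum and leaves a linear equation for the sum over all parts.
\<close>
lemma sum_part_deg: "(\<Sum>i\<in>I. part_deg i) = real s * (real s - 1) * total_weight"
proof -
  define D where "D = (\<Sum>i\<in>I. part_deg i)"
  have s1: "real s - 1 > 0" using s_ge by simp
  have i: "1 \<in> I" by (simp add: I_def)
  have rest: "(\<Sum>j\<in>I - {1}. part_deg j) = D - part_deg 1" using i by (simp add: D_def sum_diff1)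
  have "part_deg 1 = (\<Sum>j\<in>I - {1}. (part_deg 1 + part_deg j) / (real s - 1) - total_weight)"
    using i by (subst part_deg_eq) (auto intro!: sum.cong card_pair_edges_admissible)
  also have "\<dots> = (real s * part_deg 1 + (D - part_deg 1)) / (real s - 1) - real s * total_weight"
    using i by (simp only: sum_subtractf sum_divide_distrib[symmetric] sum.distrib rest) simp
  finally have "D = real s * (real s - 1) * total_weight" using s1 by (simp add: field_simps)
  then show ?thesis by (simp add: D_def)
qed

lemma sum_missing_weight: "(\<Sum>k\<in>I. missing_weight k) = total_weight"
proof -
  have "(\<Sum>k\<in>I. missing_weight k) = (real s + 1) * total_weight - real s * (real s - 1) * total_weight / (real s - 1)"
    unfolding missing_weight_def
    by (simp only: sum_subtractf sum_divide_distrib[symmetric] sum_part_deg) simp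
  also have "real s * (real s - 1) * total_weight / (real s - 1) = real s * total_weight" using s_ge by simp
  finally show ?thesis by (simp add: algebra_simps)
qed

text \<open>
  The copies using an edge between the two parts in \<open>p\<close> are those missing some other part; this is
  where the admissibility condition makes the total load on each pair of parts correct.
\<close>
lemma sum_missing_weight_pair:
  assumes "p \<in> [I]\<^bsup>2\<^esup>"
  shows "(\<Sum>k\<in>I - p. missing_weight k) = real (card (pair_edges p))"
proof -
  obtain i j where p: "p = {i, j}" "i \<in> I" "j \<in> I" "i \<noteq> j"
    using assms by (auto simp: nsets_def card_2_iff)
  have "(\<Sum>k\<in>I - p. missing_weight k) = total_weight - (missing_weight i + missing_weight j)"
    using p sum_missing_weight sum.subset_diff[of p I missing_weight] by simp
  then show ?thesis
    using card_pair_edges_admissible p by (simp add: missing_weight_def add_divide_distrib)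
qed

lemma missing_weight_ge:
  assumes "k \<in> I"
  shows "real n ^ 2 * (1 - (real s + 1) * c) / (real s - 1) \<le> missing_weight k"
proof -
  have s1: "real s - 1 > 0" using s_ge by simp
  have up: "part_deg k \<le> real s * real n ^ 2"
  proof -
    have "part_deg k \<le> (\<Sum>j\<in>I - {k}. real n ^ 2)"
      unfolding part_deg_eq[OF assms] using assms by (intro sum_mono card_pair_edges_bounds) auto
    then show ?thesis using assms by simp
  qed
  have low: "real s * ((1 - c) * real n ^ 2) \<le> part_deg i" if "i \<in> I" for i
  proof -
    have "(\<Sum>j\<in>I - {i}. (1 - c) * real n ^ 2) \<le> part_deg i"
      unfolding part_deg_eq[OF that] using that by (intro sum_mono card_pair_edges_bounds) auto
    then show ?thesis using that by simp
  qed
  have "(\<Sum>i\<in>I. real s * ((1 - c) * real n ^ 2)) \<le> (\<Sum>i\<in>I. part_deg i)" by (intro sum_mono low)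
  then have "real s * ((real s + 1) * ((1 - c) * real n ^ 2)) \<le> real s * ((real s - 1) * total_weight)"
    unfolding sum_part_deg by (simp add: algebra_simps)
  then have "(real s + 1) * ((1 - c) * real n ^ 2) \<le> (real s - 1) * total_weight"
    using s_ge by (subst (asm) mult_le_cancel_left_pos) auto
  with up have "real n ^ 2 * (1 - (real s + 1) * c) \<le> (real s - 1) * total_weight - part_deg k"
    by (simp add: algebra_simps)
  then have "real n ^ 2 * (1 - (real s + 1) * c) / (real s - 1) \<le> ((real s - 1) * total_weight - part_deg k) / (real s - 1)"
    using s1 by (intro divide_right_mono) auto
  also have "\<dots> = missing_weight k"
    using s1 by (simp add: missing_weight_def diff_divide_distrib)
  finally show ?thesis .
qed

lemma missing_weight_pos: "k \<in> I \<Longrightarrow> 0 < missing_weight k"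
proof -
  assume "k \<in> I"
  moreover have "0 < real n ^ 2 * (1 - (real s + 1) * c) / (real s - 1)"
    using loss_bounds(5) n_pos s_ge by (intro divide_pos_pos mult_pos_pos) auto
  ultimately show ?thesis using missing_weight_ge by fastforce
qed

section \<open>The initial weighting\<close>

definition "cliques k = {t \<in> transversals. complete_on t (I - {k})}"

text \<open>
  The vertex of \<open>t\<close> in the missed part \<open>k\<close> is irrelevant, so each copy is counted \<open>n\<close> times, both
  here and in \<open>cliques k\<close>.
\<close>
definition initial :: "(nat \<Rightarrow> 'a) \<Rightarrow> nat \<Rightarrow> real" where
  "initial t k = of_bool (complete_on t (I - {k})) * (missing_weight k / real (card (cliques k)))"

lemma finite_cliques [simp]: "finite (cliques k)"
  by (simp add: cliques_def)

text \<open>Each clique missing \<open>k\<close> contains exactly one edge between the two parts in \<open>p\<close>.\<close>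
lemma card_cliques:
  assumes p: "p \<in> [I]\<^bsup>2\<^esup>" "k \<in> I - p"
  shows "(\<Sum>e\<in>pair_edges p. real (card (cliques_through k e))) = real (card (cliques k))"
proof -
  have "cliques k = (\<Union>e\<in>pair_edges p. cliques_through k e)"
  proof (intro set_eqI iffI)
    fix t assume t: "t \<in> cliques k"
    have sub: "p \<subseteq> I - {k}" "p \<in> [I - {k}]\<^bsup>2\<^esup>" using p by (auto simp: nsets_def)
    have "t ` p \<in> edges G" using t sub by (auto simp: cliques_def complete_on_def)
    moreover have "part_of ` t ` p = p"
    proof -
      have "part_of (t i) = i" if "i \<in> p" for i
        using that sub t by (auto simp: cliques_def intro!: part_of_eq transversal_in)
      then show ?thesis by (auto simp: image_image)
    qed
    ultimately have "t ` p \<in> pair_edges p" by (simp add: pair_edges_def)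
    moreover have "t \<in> cliques_through k (t ` p)"
      using t sub by (auto simp: cliques_def cliques_through_def)
    ultimately show "t \<in> (\<Union>e\<in>pair_edges p. cliques_through k e)" by blast
  qed (auto simp: cliques_def cliques_through_def)
  moreover have "card (\<Union>e\<in>pair_edges p. cliques_through k e) = (\<Sum>e\<in>pair_edges p. card (cliques_through k e))"
    using p edge_in_transversal_iff_pair[OF _ p(1)]
    by (intro card_UN_disjoint) (auto simp: cliques_through_def)
  ultimately show ?thesis by simp
qed

lemma cliques_through_bounds:
  assumes p: "p \<in> [I]\<^bsup>2\<^esup>" "k \<in> I - p" and e: "e \<in> pair_edges p"
  shows "(1 - clique_loss * c) * real n ^ (s - 1) \<le> real (card (cliques_through k e))"
    and "real (card (cliques_through k e)) \<le> real n ^ (s - 1)"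
proof -
  obtain i j where ij: "p = {i, j}" "i \<in> I" "j \<in> I" "i \<noteq> j"
    using p by (auto simp: nsets_def card_2_iff)
  obtain u v where uv: "u \<in> V i" "v \<in> V j" "e = {u, v}" "{u, v} \<in> edges G"
    using e ij pair_edgesE by metis
  show "(1 - clique_loss * c) * real n ^ (s - 1) \<le> real (card (cliques_through k e))"
    "real (card (cliques_through k e)) \<le> real n ^ (s - 1)"
    using card_cliques_through[OF ij(2-4) uv(1,2,4), of k] p ij uv by auto
qed

lemma card_cliques_bounds:
  shows "p \<in> [I]\<^bsup>2\<^esup> \<Longrightarrow> k \<in> I - p \<Longrightarrow>
      real (card (pair_edges p)) * ((1 - clique_loss * c) * real n ^ (s - 1)) \<le> real (card (cliques k))"
    and "real (card (cliques k)) \<le> real n ^ (s + 1)"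
proof -
  assume p: "p \<in> [I]\<^bsup>2\<^esup>" "k \<in> I - p"
  have "(\<Sum>e\<in>pair_edges p. (1 - clique_loss * c) * real n ^ (s - 1)) \<le> real (card (cliques k))"
    unfolding card_cliques[OF p, symmetric] using p by (intro sum_mono cliques_through_bounds)
  then show "real (card (pair_edges p)) * ((1 - clique_loss * c) * real n ^ (s - 1)) \<le> real (card (cliques k))"
    by simp
next
  have "card (cliques k) \<le> card transversals"
    by (intro card_mono) (auto simp: cliques_def)
  then show "real (card (cliques k)) \<le> real n ^ (s + 1)"
    unfolding card_transversals of_nat_power[symmetric] of_nat_le_iff .
qed

lemma pair_edges_pos: "p \<in> [I]\<^bsup>2\<^esup> \<Longrightarrow> 0 < real (card (pair_edges p))"
proof -
  assume "p \<in> [I]\<^bsup>2\<^esup>"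
  then obtain i j where ij: "p = {i, j}" "i \<in> I" "j \<in> I" "i \<noteq> j"
    by (auto simp: nsets_def card_2_iff)
  have "0 < (1 - c) * real n ^ 2" using c_bounds n_pos by simp
  also have "\<dots> \<le> real (card (pair_edges p))" using card_pair_edges_bounds ij by simp
  finally show ?thesis .
qed

lemma card_cliques_pos:
  assumes "k \<in> I" shows "0 < real (card (cliques k))"
proof -
  have "card (I - {k}) = s" using assms by simp
  then have "2 \<le> card (I - {k})" using s_ge by simp
  then obtain p where "p \<subseteq> I - {k}" "card p = 2" by (rule obtain_subset_with_card_n)
  then have p: "p \<in> [I]\<^bsup>2\<^esup>" "k \<in> I - p"
    using assms by (auto simp: nsets_def intro: finite_subset)
  have "0 < real (card (pair_edges p)) * ((1 - clique_loss * c) * real n ^ (s - 1))"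
    using pair_edges_pos[OF p(1)] loss_bounds(2) n_pos by (intro mult_pos_pos) auto
  also have "\<dots> \<le> real (card (cliques k))" by (rule card_cliques_bounds(1)[OF p])
  finally show ?thesis .
qed

lemma load_initial:
  assumes p: "p \<in> [I]\<^bsup>2\<^esup>" and e: "e \<in> pair_edges p"
  shows "load initial e = (\<Sum>k\<in>I - p. missing_weight k / real (card (cliques k)) * real (card (cliques_through k e)))"
proof -
  let ?q = "\<lambda>k. missing_weight k / real (card (cliques k))"
  have "load initial e = (\<Sum>k\<in>I. \<Sum>t\<in>transversals. of_bool (e \<subseteq> t ` (I - {k})) * initial t k)"
    unfolding load_def by (rule sum.swap)
  also have "\<dots> = (\<Sum>k\<in>I. \<Sum>t\<in>transversals. ?q k * of_bool (t \<in> cliques_through k e))"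
    by (intro sum.cong refl) (auto simp: initial_def cliques_through_def)
  also have "\<dots> = (\<Sum>k\<in>I. ?q k * real (card (cliques_through k e)))"
  proof (rule sum.cong[OF refl])
    fix k
    have "transversals \<inter> {t. t \<in> cliques_through k e} = cliques_through k e"
      by (auto simp: cliques_through_def)
    then have "(\<Sum>t\<in>transversals. of_bool (t \<in> cliques_through k e)) = real (card (cliques_through k e))"
      by simp
    then show "(\<Sum>t\<in>transversals. ?q k * of_bool (t \<in> cliques_through k e)) = ?q k * real (card (cliques_through k e))"
      by (simp only: sum_distrib_left[symmetric])
  qed
  also have "\<dots> = (\<Sum>k\<in>I - p. ?q k * real (card (cliques_through k e)))"
  proof (rule sum.mono_neutral_right)
    show "\<forall>k\<in>I - (I - p). ?q k * real (card (cliques_through k e)) = 0"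
      using edge_in_transversal_iff_pair[OF _ p e] by (auto simp: cliques_through_def)
  qed auto
  finally show ?thesis .
qed

text \<open>
  The numbers of cliques through two edges differ by at most \<open>clique_loss * c * n ^ (s - 1)\<close>, and their
  average is at least \<open>(1 - clique_loss * c) * n ^ (s - 1)\<close>; hence this bound for the variation of the load.
\<close>
definition "spread = clique_loss * c / (1 - clique_loss * c)"

lemma sum_deficit:
  assumes p: "p \<in> [I]\<^bsup>2\<^esup>"
  shows "(\<Sum>e\<in>pair_edges p. 1 - load initial e) = 0"
proof -
  have "(\<Sum>e\<in>pair_edges p. load initial e) =
      (\<Sum>e\<in>pair_edges p. \<Sum>k\<in>I - p. missing_weight k / real (card (cliques k)) * real (card (cliques_through k e)))"
    by (intro sum.cong refl load_initial p)
  also have "\<dots> = (\<Sum>k\<in>I - p. missing_weight k / real (card (cliques k)) *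
      (\<Sum>e\<in>pair_edges p. real (card (cliques_through k e))))"
    unfolding sum_distrib_left by (rule sum.swap)
  also have "\<dots> = (\<Sum>k\<in>I - p. missing_weight k)"
  proof (intro sum.cong refl)
    fix k assume k: "k \<in> I - p"
    have cancel: "x / z * z = x" if "0 < z" for x z :: real using that by simp
    show "missing_weight k / real (card (cliques k)) *
      (\<Sum>e\<in>pair_edges p. real (card (cliques_through k e))) = missing_weight k"
      unfolding card_cliques[OF p k] by (rule cancel[OF card_cliques_pos]) (use k in auto)
  qed
  finally show ?thesis using sum_missing_weight_pair[OF p] by (simp add: sum_subtractf)
qed

lemma deficit_range:
  assumes p: "p \<in> [I]\<^bsup>2\<^esup>" and e: "e \<in> pair_edges p" "e' \<in> pair_edges p"
  shows "(1 - load initial e) - (1 - load initial e') \<le> spread"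
proof -
  let ?m = "real (card (pair_edges p))" and ?N = "real n ^ (s - 1)"
  have pos: "0 < 1 - clique_loss * c" "0 < ?N" "0 < ?m"
    using loss_bounds(2) n_pos pair_edges_pos[OF p] by auto
  have "(1 - load initial e) - (1 - load initial e') = load initial e' - load initial e" by simp
  also have "\<dots> = (\<Sum>k\<in>I - p. missing_weight k / real (card (cliques k)) *
      (real (card (cliques_through k e')) - real (card (cliques_through k e))))"
    unfolding load_initial[OF p e(1)] load_initial[OF p e(2)]
    by (simp only: sum_subtractf[symmetric] right_diff_distrib)
  also have "\<dots> \<le> (\<Sum>k\<in>I - p. missing_weight k / (?m * ((1 - clique_loss * c) * ?N)) * (clique_loss * c * ?N))"
  proof (rule sum_mono)
    fix k assume k: "k \<in> I - p"
    note b = cliques_through_bounds[OF p k e(1)] cliques_through_bounds[OF p k e(2)]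
    have mw: "0 < missing_weight k" "0 < real (card (cliques k))"
      using k missing_weight_pos card_cliques_pos by auto
    have "missing_weight k / real (card (cliques k)) *
      (real (card (cliques_through k e')) - real (card (cliques_through k e)))
       \<le> missing_weight k / real (card (cliques k)) * (clique_loss * c * ?N)"
    proof (rule mult_left_mono)
      have "(1 - clique_loss * c) * ?N = ?N - clique_loss * c * ?N" by (simp add: algebra_simps)
      with b(1,4) show "real (card (cliques_through k e')) - real (card (cliques_through k e)) \<le> clique_loss * c * ?N"
        by linarith
    qed (use mw in auto)
    also have "\<dots> \<le> missing_weight k / (?m * ((1 - clique_loss * c) * ?N)) * (clique_loss * c * ?N)"
      using mw pos card_cliques_bounds(1)[OF p k] loss_bounds(1)
      by (intro mult_right_mono divide_left_mono mult_pos_pos) auto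
    finally show "missing_weight k / real (card (cliques k)) *
      (real (card (cliques_through k e')) - real (card (cliques_through k e)))
       \<le> missing_weight k / (?m * ((1 - clique_loss * c) * ?N)) * (clique_loss * c * ?N)" .
  qed
  also have "\<dots> = ?m / (?m * ((1 - clique_loss * c) * ?N)) * (clique_loss * c * ?N)"
    by (simp only: sum_divide_distrib[symmetric] sum_distrib_right[symmetric] sum_missing_weight_pair[OF p])
  also have "\<dots> = spread"
  proof -
    have "m / (m * (a * N)) * (x * N) = x / a" if "0 < a" "0 < N" "0 < m" for a x m N :: real
      using that by simp
    from this[OF pos] show ?thesis by (simp only: spread_def)
  qed
  finally show ?thesis .
qed

section \<open>The correction stays below the initial weight\<close>

text \<open>Among the pairs of parts, \<open>s\<close> contain \<open>k\<close> and \<open>s choose 2\<close> do not.\<close>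
lemma sum_step_cost:
  assumes "k \<in> I"
  shows "(\<Sum>p\<in>[I]\<^bsup>2\<^esup>. step_cost p k) = real s * (3 * real s - 5) / 2 / (real s - 1)"
proof -
  have sub: "[I - {k}]\<^bsup>2\<^esup> \<subseteq> [I]\<^bsup>2\<^esup>" by (intro nsets_mono) auto
  have fin: "finite ([I]\<^bsup>2\<^esup>)" by (simp add: finite_imp_finite_nsets)
  have c1: "card ([I - {k}]\<^bsup>2\<^esup>) = s choose 2" "card ([I]\<^bsup>2\<^esup>) = (s + 1) choose 2"
    using assms by (simp_all add: card_nsets)
  have c2: "card ([I]\<^bsup>2\<^esup> - [I - {k}]\<^bsup>2\<^esup>) = s"
    using sub fin c1 by (subst card_Diff_subset) (auto intro: finite_subset simp: numeral_2_eq_2)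
  have "(\<Sum>p\<in>[I]\<^bsup>2\<^esup>. step_cost p k) = (\<Sum>p\<in>[I]\<^bsup>2\<^esup> - [I - {k}]\<^bsup>2\<^esup>. step_cost p k) + (\<Sum>p\<in>[I - {k}]\<^bsup>2\<^esup>. step_cost p k)"
    by (rule sum.subset_diff[OF sub fin])
  also have "(\<Sum>p\<in>[I]\<^bsup>2\<^esup> - [I - {k}]\<^bsup>2\<^esup>. step_cost p k) = (\<Sum>p\<in>[I]\<^bsup>2\<^esup> - [I - {k}]\<^bsup>2\<^esup>. (real s - 2) / (real s - 1))"
    by (rule sum.cong) (auto simp: step_cost_def nsets_def)
  also have "(\<Sum>p\<in>[I - {k}]\<^bsup>2\<^esup>. step_cost p k) = (\<Sum>p\<in>[I - {k}]\<^bsup>2\<^esup>. 1 / (real s - 1))"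
    by (rule sum.cong) (auto simp: step_cost_def nsets_def)
  also have "(\<Sum>p\<in>[I]\<^bsup>2\<^esup> - [I - {k}]\<^bsup>2\<^esup>. (real s - 2) / (real s - 1)) = real s * (real s - 2) / (real s - 1)"
    by (simp add: c2)
  also have "(\<Sum>p\<in>[I - {k}]\<^bsup>2\<^esup>. 1 / (real s - 1)) = real s * (real s - 1) / 2 / (real s - 1)"
    by (simp only: sum_constant c1 real_choose_two) simp
  also have "real s * (real s - 2) / (real s - 1) + real s * (real s - 1) / 2 / (real s - 1)
      = real s * (3 * real s - 5) / 2 / (real s - 1)"
    unfolding add_divide_distrib[symmetric] by (simp add: field_simps)
  finally show ?thesis .
qed

text \<open>
  Multiplied by \<open>(s - 1) n ^ (s - 1)\<close>, the correction is at most about \<open>3 clique_loss c\<close> times \<open>s (3 s - 5) / 2\<close>,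
  at most 4 / 9 up to lower order terms, whereas the initial weight is close to 1. The fractions in the proof are the
  values of the error terms at \<open>s = 3\<close>, the worst case.
\<close>
lemma correction_small:
  assumes k: "k \<in> I"
  shows "step_scale * (real s * (3 * real s - 5) / 2 / (real s - 1)) * (spread * (1 + 2 / (1 - 2 * c)))
     \<le> missing_weight k / real (card (cliques k))"
proof -
  define S where "S = real s * (3 * real s - 5) / 2"
  define N where "N = real n ^ (s - 1)"
  have s1: "0 < real s - 1" using s_ge by simp
  have N: "0 < N" using n_pos by (simp add: N_def)
  have S0: "0 \<le> S" using s_ge by (simp add: S_def)
  have e': "0 < 1 - swap_loss * c" using loss_bounds by simp
  have q: "1 + 2 / (1 - 2 * c) \<le> 241 / 79"
  proof -
    have "2 / (1 - 2 * c) \<le> 2 / (79 / 81)" using c_bounds by (intro divide_left_mono) auto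
    then show ?thesis by simp
  qed
  have "S * spread \<le> (4 / 27) / (79 / 81)"
    unfolding spread_def times_divide_eq_right
    using loss_bounds(6) loss_bounds(1,2) by (intro frac_le) (auto simp: S_def)
  then have "(S * spread) * (1 + 2 / (1 - 2 * c)) \<le> (4 / 27) / (79 / 81) * (241 / 79)"
    using q c_bounds S0 loss_bounds by (intro mult_mono) (auto simp: spread_def)
  also have "\<dots> \<le> (77 / 81) * (74 / 81 :: real)" by simp
  also have "\<dots> \<le> (1 - (real s + 1) * c) * (1 - swap_loss * c)"
    using loss_bounds by (intro mult_mono) auto
  finally have main: "(S * spread) * (1 + 2 / (1 - 2 * c)) \<le> (1 - (real s + 1) * c) * (1 - swap_loss * c)" .
  have "step_scale * (S / (real s - 1)) * (spread * (1 + 2 / (1 - 2 * c)))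
      = (S * spread) * (1 + 2 / (1 - 2 * c)) / ((1 - swap_loss * c) * N * (real s - 1))"
    by (simp add: step_scale_def N_def)
  also have "\<dots> \<le> (1 - (real s + 1) * c) * (1 - swap_loss * c) / ((1 - swap_loss * c) * N * (real s - 1))"
    using main e' N s1 by (intro divide_right_mono) auto
  also have "\<dots> = (1 - (real s + 1) * c) / (N * (real s - 1))" using e' by simp
  also have "\<dots> = (real n ^ 2 * (1 - (real s + 1) * c) / (real s - 1)) / real n ^ (s + 1)"
  proof -
    have "s + 1 = 2 + (s - 1)" using s_ge by simp
    then have "real n ^ (s + 1) = real n ^ 2 * N" by (simp only: N_def power_add)
    then show ?thesis using n_pos by simp
  qed
  also have "\<dots> \<le> missing_weight k / real (card (cliques k))"
    using missing_weight_ge[OF k] missing_weight_pos[OF k] card_cliques_pos[OF k] card_cliques_bounds(2)[of k]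
    by (intro frac_le) auto
  finally show ?thesis by (simp only: S_def)
qed

lemma exact_weighting:
  obtains \<omega> where "\<And>t k. t \<in> transversals \<Longrightarrow> k \<in> I \<Longrightarrow> 0 \<le> \<omega> t k"
    and "\<And>t k. t \<in> transversals \<Longrightarrow> k \<in> I \<Longrightarrow> \<omega> t k \<noteq> 0 \<Longrightarrow> complete_on t (I - {k})"
    and "\<And>e. e \<in> edges G \<Longrightarrow> load \<omega> e = 1"
proof -
  define r where "r = spread * (1 + 2 / (1 - 2 * c))"
  have spread_nonneg: "0 \<le> spread" using loss_bounds by (simp add: spread_def)
  have "correctable (\<lambda>f. 1 - load initial f) (\<lambda>t k. missing_weight k / real (card (cliques k)))"
  proof (rule correctable_mono[OF correctable_sum[where Q = "[I]\<^bsup>2\<^esup>" and a = "\<lambda>_. 1"]])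
    fix p assume p: "p \<in> [I]\<^bsup>2\<^esup>"
    show "correctable (\<lambda>f. of_bool (f \<in> pair_edges p) * (1 - load initial f)) (\<lambda>t k. step_scale * step_cost p k * r)"
      unfolding r_def using p sum_deficit deficit_range spread_nonneg by (intro correctable_pair) auto
  next
    fix f assume f: "f \<in> edges G"
    then obtain i j u v where *: "i \<in> I" "j \<in> I" "i \<noteq> j" "u \<in> V i" "v \<in> V j" "f = {u, v}"
      by (rule edge_cases)
    then have "part_of ` f = {i, j}" by (simp add: part_of_eq)
    then have in_nsets: "part_of ` f \<in> [I]\<^bsup>2\<^esup>" using * by (simp add: nsets_def)
    have "(\<Sum>p\<in>[I]\<^bsup>2\<^esup>. 1 * (of_bool (f \<in> pair_edges p) * (1 - load initial f)))
        = (\<Sum>p\<in>[I]\<^bsup>2\<^esup>. if part_of ` f = p then 1 - load initial f else 0)"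
      using f by (intro sum.cong) (auto simp: pair_edges_def)
    also have "\<dots> = 1 - load initial f"
      using in_nsets by (simp add: finite_imp_finite_nsets)
    finally show "(\<Sum>p\<in>[I]\<^bsup>2\<^esup>. 1 * (of_bool (f \<in> pair_edges p) * (1 - load initial f))) = 1 - load initial f" .
  next
    fix t k assume "t \<in> transversals" "k \<in> I"
    have "(\<Sum>p\<in>[I]\<^bsup>2\<^esup>. \<bar>1\<bar> * (step_scale * step_cost p k * r)) = step_scale * (\<Sum>p\<in>[I]\<^bsup>2\<^esup>. step_cost p k) * r"
      by (simp add: sum_distrib_left sum_distrib_right)
    also have "\<dots> \<le> missing_weight k / real (card (cliques k))"
      unfolding sum_step_cost[OF \<open>k \<in> I\<close>] r_def by (rule correction_small) fact
    finally show "(\<Sum>p\<in>[I]\<^bsup>2\<^esup>. \<bar>1\<bar> * (step_scale * step_cost p k * r)) \<le> missing_weight k / real (card (cliques k))" .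
  qed
  then obtain \<omega> where \<omega>: "\<And>t k. t \<in> transversals \<Longrightarrow> k \<in> I \<Longrightarrow> \<bar>\<omega> t k\<bar> \<le> missing_weight k / real (card (cliques k))"
    "\<And>t k. t \<in> transversals \<Longrightarrow> k \<in> I \<Longrightarrow> \<omega> t k \<noteq> 0 \<Longrightarrow> complete_on t (I - {k})"
    "\<And>e. e \<in> edges G \<Longrightarrow> load \<omega> e = 1 - load initial e"
    unfolding correctable_def by blast
  show thesis
  proof (rule that[of "\<lambda>t k. initial t k + \<omega> t k"])
    fix t k assume tk: "t \<in> transversals" "k \<in> I"
    show "0 \<le> initial t k + \<omega> t k"
    proof (cases "complete_on t (I - {k})")
      case True
      then show ?thesis using \<omega>(1)[OF tk] by (simp add: initial_def)
    next
      case False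
      then have "\<omega> t k = 0" using \<omega>(2)[OF tk] by blast
      with False show ?thesis by (simp add: initial_def)
    qed
    show "complete_on t (I - {k})" if "initial t k + \<omega> t k \<noteq> 0"
    proof (rule ccontr)
      assume not: "\<not> complete_on t (I - {k})"
      then have "\<omega> t k = 0" using \<omega>(2)[OF tk] by blast
      with not that show False by (simp add: initial_def)
    qed
  next
    fix e assume "e \<in> edges G"
    then show "load (\<lambda>t k. initial t k + \<omega> t k) e = 1"
      using \<omega>(3) by (simp add: load_def distrib_left sum.distrib)
  qed
qed

section \<open>From transversals to copies\<close>

definition copy :: "(nat \<Rightarrow> 'a) \<Rightarrow> nat \<Rightarrow> 'a sgraph" where
  "copy t k = \<lparr>verts = t ` (I - {k}), edges = [t ` (I - {k})]\<^bsup>2\<^esup>\<rparr>"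

lemma copy_in_clique_copies:
  assumes t: "t \<in> transversals" "k \<in> I" and comp: "complete_on t (I - {k})"
  shows "copy t k \<in> clique_copies s G"
proof -
  let ?S = "t ` (I - {k})"
  have inj: "inj_on t (I - {k})" using transversal_inj[OF t(1)] by (rule inj_on_subset) auto
  have cardS: "card ?S = s" using card_image[OF inj] t(2) by simp
  have finS: "finite ?S" by simp
  have "?S \<subseteq> verts G" using t(1) by (auto simp: verts_eq transversal_in)
  moreover have "[?S]\<^bsup>2\<^esup> \<subseteq> edges G"
  proof
    fix e assume e: "e \<in> [?S]\<^bsup>2\<^esup>"
    then obtain x y where xy: "e = {x, y}" "x \<noteq> y" "x \<in> ?S" "y \<in> ?S"
      by (auto simp: nsets_def card_2_iff)
    then obtain a b where "a \<in> I - {k}" "b \<in> I - {k}" "x = t a" "y = t b" by blast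
    with xy have "a \<in> I - {k}" "b \<in> I - {k}" "e = t ` {a, b}" "a \<noteq> b" by auto
    moreover from this have "{a, b} \<in> [I - {k}]\<^bsup>2\<^esup>" by (auto simp: nsets_def)
    ultimately show "e \<in> edges G" using comp unfolding complete_on_def by blast
  qed
  ultimately have "subgraph_of (copy t k) G"
    by (simp add: subgraph_of_def copy_def simple_graph_def)
  moreover have "isomorphic (copy t k) (complete_graph s)"
  proof -
    obtain f where f: "bij_betw f ?S {..<s}"
      using ex_bij_betw_finite_nat[OF finS] cardS by (auto simp: atLeast0LessThan)
    show ?thesis
      unfolding isomorphic_def copy_def complete_graph_def
    proof (intro exI[of _ f] conjI ballI)
      show "bij_betw f (verts \<lparr>verts = ?S, edges = [?S]\<^bsup>2\<^esup>\<rparr>)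
         (verts \<lparr>verts = {..<s}, edges = [{..<s}]\<^bsup>2\<^esup>\<rparr>)" using f by simp
      fix u v assume "u \<in> verts \<lparr>verts = ?S, edges = [?S]\<^bsup>2\<^esup>\<rparr>" "v \<in> verts \<lparr>verts = ?S, edges = [?S]\<^bsup>2\<^esup>\<rparr>"
      then have uv: "u \<in> ?S" "v \<in> ?S" by auto
      then have "f u \<in> {..<s}" "f v \<in> {..<s}" "f u = f v \<longleftrightarrow> u = v"
        using f by (auto simp: bij_betw_def inj_on_eq_iff)
      then show "{u, v} \<in> edges \<lparr>verts = ?S, edges = [?S]\<^bsup>2\<^esup>\<rparr> \<longleftrightarrow>
         {f u, f v} \<in> edges \<lparr>verts = {..<s}, edges = [{..<s}]\<^bsup>2\<^esup>\<rparr>"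
        using uv by (auto simp: nsets_def card_2_iff doubleton_eq_iff)
    qed
  qed
  ultimately show ?thesis by (simp add: clique_copies_def)
qed

lemma finite_clique_copies: "finite (clique_copies s G)"
proof -
  have "finite (verts G)" using partite by (simp add: partite_def simple_graph_def)
  then have "finite ((\<lambda>(A, B). \<lparr>verts = A, edges = B\<rparr>) ` (Pow (verts G) \<times> Pow (edges G)))"
    by simp
  moreover have "clique_copies s G \<subseteq> (\<lambda>(A, B). \<lparr>verts = A, edges = B\<rparr>) ` (Pow (verts G) \<times> Pow (edges G))"
  proof
    fix H assume "H \<in> clique_copies s G"
    then have "verts H \<in> Pow (verts G)" "edges H \<in> Pow (edges G)"
      by (auto simp: clique_copies_def subgraph_of_def)
    moreover have "H = \<lparr>verts = verts H, edges = edges H\<rparr>" by simp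
    ultimately show "H \<in> (\<lambda>(A, B). \<lparr>verts = A, edges = B\<rparr>) ` (Pow (verts G) \<times> Pow (edges G))"
      by (metis (no_types, lifting) SigmaI case_prod_conv image_eqI)
  qed
  ultimately show ?thesis by (rule finite_subset[rotated])
qed

lemma edge_in_copy_iff: "e \<in> edges G \<Longrightarrow> e \<in> edges (copy t k) \<longleftrightarrow> e \<subseteq> t ` (I - {k})"
proof -
  assume "e \<in> edges G"
  then have "e \<in> [verts G]\<^bsup>2\<^esup>" using partite by (auto simp: partite_def simple_graph_def)
  then show ?thesis by (auto simp: copy_def nsets_def)
qed

lemma copy_has_edge:
  assumes "t \<in> transversals" "k \<in> I"
  shows "\<exists>e. e \<in> edges (copy t k)"
proof -
  have inj: "inj_on t (I - {k})" using transversal_inj[OF assms(1)] by (rule inj_on_subset) auto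
  have "card (t ` (I - {k})) = s" using card_image[OF inj] assms(2) by simp
  then have "2 \<le> card (t ` (I - {k}))" using s_ge by simp
  then obtain e where "e \<subseteq> t ` (I - {k})" "card e = 2" "finite e"
    by (rule obtain_subset_with_card_n)
  then show ?thesis by (auto simp: copy_def nsets_def)
qed

text \<open>
  The weight of a copy collects the weights of all pairs \<open>(t, k)\<close> representing it. The bound \<open>w \<le> 1\<close>
  comes for free, since a copy has an edge whose total weight is 1.
\<close>
lemma fractional_decomposition_exists: "\<exists>w. fractional_clique_decomposition s G w"
proof -
  obtain \<omega> where \<omega>: "\<And>t k. t \<in> transversals \<Longrightarrow> k \<in> I \<Longrightarrow> 0 \<le> \<omega> t k"
    "\<And>t k. t \<in> transversals \<Longrightarrow> k \<in> I \<Longrightarrow> \<omega> t k \<noteq> 0 \<Longrightarrow> complete_on t (I - {k})"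
    "\<And>e. e \<in> edges G \<Longrightarrow> load \<omega> e = 1"
    by (rule exact_weighting) blast
  define C where "C = {q \<in> transversals \<times> I. complete_on (fst q) (I - {snd q})}"
  define H where "H q = copy (fst q) (snd q)" for q
  define w where "w K = (\<Sum>q\<in>{q \<in> C. H q = K}. case_prod \<omega> q)" for K
  have finC: "finite C" by (simp add: C_def)
  have HC: "H q \<in> clique_copies s G" if "q \<in> C" for q
    using that copy_in_clique_copies by (auto simp: C_def H_def)
  have w0: "0 \<le> w K" for K
    unfolding w_def using \<omega>(1) by (intro sum_nonneg) (auto simp: C_def)
  have total: "(\<Sum>K\<in>{K \<in> clique_copies s G. e \<in> edges K}. w K) = 1" if e: "e \<in> edges G" for e
  proof -
    let ?Ke = "{K \<in> clique_copies s G. e \<in> edges K}"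
    let ?Ce = "{q \<in> C. e \<in> edges (H q)}"
    have "(\<Sum>K\<in>?Ke. w K) = (\<Sum>K\<in>?Ke. \<Sum>q\<in>{q \<in> ?Ce. H q = K}. case_prod \<omega> q)"
      unfolding w_def by (intro sum.cong) auto
    also have "\<dots> = (\<Sum>q\<in>?Ce. case_prod \<omega> q)"
      by (rule sum.group) (use finC finite_clique_copies HC in auto)
    also have "\<dots> = (\<Sum>q\<in>transversals \<times> I. of_bool (e \<subseteq> fst q ` (I - {snd q})) * case_prod \<omega> q)"
      using e \<omega>(2) by (intro sum.mono_neutral_cong_left) (auto simp: C_def H_def edge_in_copy_iff)
    also have "\<dots> = load \<omega> e"
      by (simp only: load_def sum.cartesian_product case_prod_unfold)
    finally show ?thesis using \<omega>(3)[OF e] by simp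
  qed
  have "w K \<le> 1" if K: "K \<in> clique_copies s G" for K
  proof (cases "\<exists>q\<in>C. H q = K")
    case True
    then obtain q where q: "q \<in> C" "H q = K" by blast
    then obtain e where e: "e \<in> edges K"
      using copy_has_edge[of "fst q" "snd q"] by (auto simp: C_def H_def)
    then have eG: "e \<in> edges G" using K by (auto simp: clique_copies_def subgraph_of_def)
    have "w K \<le> (\<Sum>K\<in>{K \<in> clique_copies s G. e \<in> edges K}. w K)"
      by (rule member_le_sum) (use K e w0 finite_clique_copies in auto)
    then show ?thesis using total[OF eG] by simp
  next
    case False
    then have empty: "{q \<in> C. H q = K} = {}" by blast
    show ?thesis unfolding w_def empty by simp
  qed
  then show ?thesis
    unfolding fractional_clique_decomposition_def using w0 total by blast
qed

end

theorem theorem1p3: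
  fixes s n :: nat and c :: real and V :: "nat \<Rightarrow> 'a set" and G :: "'a sgraph"
  assumes "s \<ge> 3" and "n \<ge> 1"
    and "partite (s + 1) V G"
    and "balanced (s + 1) V"
    and "card (verts G) = (s + 1) * n"
    and "admissible s V G"
    and "real (partite_min_degree (s + 1) V G) \<ge> (1 - c) * real n"
    and "c \<le> 1 / (3 * real s ^ 3 * (real s - 2) ^ 2)"
  shows "\<exists>w. fractional_clique_decomposition s G w"
proof -
  define c0 where "c0 = 1 / (3 * real s ^ 3 * (real s - 2) ^ 2)"
  let ?J = "{1..s+1}"
  have finV: "finite (verts G)" and verts: "(\<Union>i\<in>?J. V i) = verts G"
    and disj: "disjoint_family_on V ?J"
    using assms(3) by (auto simp: partite_def simple_graph_def)
  have fin: "finite (V i)" if "i \<in> ?J" for i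
    using that finV verts by (metis UN_upper finite_subset)
  have card: "card (V i) = n" if i: "i \<in> ?J" for i
  proof -
    have "(s + 1) * n = card (\<Union>j\<in>?J. V j)" using assms(5) verts by simp
    also have "\<dots> = (\<Sum>j\<in>?J. card (V j))"
      using fin disj by (intro card_UN_disjoint) (auto simp: disjoint_family_on_def)
    also have "\<dots> = (\<Sum>j\<in>?J. card (V i))"
      using assms(4) i unfolding balanced_def by (intro sum.cong) blast+
    finally show ?thesis by (simp del: mult_Suc)
  qed
  have few: "real (card {x \<in> V i. {x, v} \<notin> edges G}) \<le> c0 * real n"
    if i: "i \<in> ?J" and v: "v \<in> verts G - V i" for i v
  proof -
    let ?M = "{degree_into G v (V i) | i v. i \<in> ?J \<and> v \<in> verts G - V i}"
    have "?M \<subseteq> (\<lambda>(i, v). degree_into G v (V i)) ` (?J \<times> verts G)" by auto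
    then have "finite ?M" using finV by (meson finite_SigmaI finite_atLeastAtMost finite_imageI finite_subset)
    then have "partite_min_degree (s + 1) V G \<le> degree_into G v (V i)"
      unfolding partite_min_degree_def using i v by (intro Min_le) auto
    then have "(1 - c) * real n \<le> real (card {x \<in> V i. {x, v} \<in> edges G})"
      using assms(7) by (simp add: degree_into_def)
    moreover have "card (V i) = card {x \<in> V i. {x, v} \<in> edges G} + card {x \<in> V i. {x, v} \<notin> edges G}"
      using fin[OF i] by (subst card_Un_disjoint[symmetric]) (auto intro!: arg_cong[where f = card])
    ultimately have "real (card {x \<in> V i. {x, v} \<notin> edges G}) \<le> c * real n"
      using card[OF i] by (simp add: algebra_simps)
    also have "\<dots> \<le> c0 * real n" using assms(8) by (intro mult_right_mono) (auto simp: c0_def)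
    finally show ?thesis .
  qed
  interpret dense_partite_graph s n c0 V G
    using assms card few by unfold_locales (auto simp: c0_def)
  show ?thesis by (rule fractional_decomposition_exists)
qed

end
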